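(* Let $G$ be a topological group. (1) The collection $\mathrm{SUC}(X)$ is a $G$-subalgebra of $\mathrm{RUC}(X)$ for every $G$-space $X$, and the corresponding Gelfand space $|\mathrm{SUC}(X)|=X^{\mathrm{SUC}}$ with the canonical compactification $j\colon X\to X^{\mathrm{SUC}}$ is the maximal SUC-compactification of $X$. (2) A compact $G$-space $X$ is SUC if and only if $C(X)=\mathrm{SUC}(X)$. (3) For every $G$-space $X$ and every $f\in\mathrm{RUC}(X)$ we have $f\in\mathrm{SUC}(X)$ if and only if $X_f$ is SUC. (4) $\mathrm{SUC}(G)$ is a point-universal closed $G$-subalgebra of $\mathrm{RUC}(G)$. (5) The canonical compactification $j\colon G\to G^{\mathrm{SUC}}$ is always a right topological semigroup compactification of $G$.
   Context: A $G$-space is a Tychonoff space with a continuous left action of $G$; a $G$-map is a continuous equivariant map; a $G$-compactification of $X$ is a $G$-map $\nu\colon X\to Y$ with dense image into a compact $G$-space $Y$. $G$ is a $G$-space under left translations. $C(X)$ is the Banach algebra of bounded continuous real functions on $X$ (supremum norm), with right action $(fg)(x)=f(gx)$ of $G$. $\mathrm{RUC}(X)$ is the set of $f\in C(X)$ for which $g\mapsto fg$ is norm continuous. A $G$-subalgebra is a norm closed unital subalgebra invariant under $f\mapsto fg$. For a $G$-subalgebra $\mathcal{A}\subset\mathrm{RUC}(X)$, its Gelfand space $|\mathcal{A}|=X^{\mathcal A}$ is a compact $G$-space, and $x\mapsto$ (evaluation at $x$) is the canonical $G$-compactification $X\to X^{\mathcal A}$. A compact $G$-space $Y$, with its unique compatible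 uniformity $\mu_Y$, is SUC if for every $y_0\in Y$ and every $\varepsilon\in\mu_Y$ there is a neighborhood $U$ of $e$ such that $(guy_0,gy_0)\in\varepsilon$ for all $g\in G$, $u\in U$. $f\in C(X)$ belongs to $\mathrm{SUC}(X)$ if $f=F\circ\nu$ for some $G$-compactification $\nu\colon X\to Y$ with $Y$ SUC and some continuous $F\colon Y\to\mathbb{R}$. A SUC-compactification of $X$ is a $G$-compactification $\nu\colon X\to Y$ with $Y$ SUC; it is maximal if every other SUC-compactification $\nu'\colon X\to Y'$ factors as $\nu'=\alpha\circ\nu$ for a $G$-map $\alpha\colon Y\to Y'$. For $f\in\mathrm{RUC}(X)$ let $\Omega=[-\|f\|,\|f\|]^G$ with the product topology and action $(g\omega)(h)=\omega(hg)$; with $f_\sharp(x)(g)=f(gx)$ put $X_f=\mathrm{cl}(f_\sharp(X))\subset\Omega$, which is a compact $G$-space. A pointed compact $G$-system $(X,x_0)$ with $Gx_0$ dense is point-universal if for every $x\in X$ there is a $G$-map $X\to\mathrm{cl}(Gx)$ sending $x_0$ to $x$. A $G$-subalgebra $\mathcal{A}\subset\mathrm{RUC}(G)$ is point-universal if $(G^{\mathcal A},\text{evaluation at }e)$ is point-universal. A $G$-compactification $\nu\colon G\to S$ is a right topological semigroup compactification if $S$ is a compact semigroup such that $s\mapsto sp$ is continuous for each $p\in S$ and $\nu$ is a semigroup homomorphism. *)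

theory Defs
  imports "HOL-Analysis.Analysis"
begin

text \<open>
  The acting group is a type of class \<open>topological_group_add\<close>: an arbitrary, not necessarily
  abelian, topological group, written additively (so \<open>g + h\<close> is $gh$ and \<open>0\<close> is $e$).
  Spaces are abstract topologies \<open>X\<close> with carrier \<open>topspace X\<close>, so that subspaces,
  closures and Gelfand spaces are again spaces; an action is a function
  \<open>act :: 'g \<Rightarrow> 'x \<Rightarrow> 'x\<close>, of which only the values on \<open>topspace X\<close> matter.
\<close>

section \<open>G-spaces and G-compactifications\<close>

definition continuous_action :: "'x topology \<Rightarrow> ('g::topological_group_add \<Rightarrow> 'x \<Rightarrow> 'x) \<Rightarrow> bool" where
  "continuous_action X act \<longleftrightarrow>
     (\<forall>x\<in>topspace X. act 0 x = x) \<and>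
     (\<forall>g h. \<forall>x\<in>topspace X. act (g + h) x = act g (act h x)) \<and>
     continuous_map (prod_topology euclidean X) X (\<lambda>(g, x). act g x)"

definition G_space :: "'x topology \<Rightarrow> ('g::topological_group_add \<Rightarrow> 'x \<Rightarrow> 'x) \<Rightarrow> bool" where
  "G_space X act \<longleftrightarrow> completely_regular_space X \<and> Hausdorff_space X \<and> continuous_action X act"

definition compact_G_space :: "'x topology \<Rightarrow> ('g::topological_group_add \<Rightarrow> 'x \<Rightarrow> 'x) \<Rightarrow> bool" where
  "compact_G_space X act \<longleftrightarrow> compact_space X \<and> G_space X act"

definition G_map ::
  "'x topology \<Rightarrow> ('g::topological_group_add \<Rightarrow> 'x \<Rightarrow> 'x) \<Rightarrow>
   'y topology \<Rightarrow> ('g \<Rightarrow> 'y \<Rightarrow> 'y) \<Rightarrow> ('x \<Rightarrow> 'y) \<Rightarrow> bool" where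
  "G_map X actX Y actY \<nu> \<longleftrightarrow>
     continuous_map X Y \<nu> \<and> (\<forall>g. \<forall>x\<in>topspace X. \<nu> (actX g x) = actY g (\<nu> x))"

definition G_compactification ::
  "'x topology \<Rightarrow> ('g::topological_group_add \<Rightarrow> 'x \<Rightarrow> 'x) \<Rightarrow>
   'y topology \<Rightarrow> ('g \<Rightarrow> 'y \<Rightarrow> 'y) \<Rightarrow> ('x \<Rightarrow> 'y) \<Rightarrow> bool" where
  "G_compactification X actX Y actY \<nu> \<longleftrightarrow>
     compact_G_space Y actY \<and> G_map X actX Y actY \<nu> \<and>
     Y closure_of (\<nu> ` topspace X) = topspace Y"

section \<open>The algebras C(X) and RUC(X)\<close>

text \<open>
  \<open>cfunspace X euclidean_metric\<close> carries the supremum metric; its points are extensional, i.e.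
  they take the value \<open>undefined\<close> outside \<open>topspace X\<close>, hence are determined by their
  restrictions to \<open>X\<close>.
\<close>

definition C_metric :: "'x topology \<Rightarrow> ('x \<Rightarrow> real) metric" where
  "C_metric X = cfunspace X euclidean_metric"

definition C_alg :: "'x topology \<Rightarrow> ('x \<Rightarrow> real) set" where
  "C_alg X = mspace (C_metric X)"

definition sup_norm :: "'x topology \<Rightarrow> ('x \<Rightarrow> real) \<Rightarrow> real" where
  "sup_norm X f = mdist (C_metric X) f (\<lambda>x\<in>topspace X. 0)"

definition rtrans ::
  "'x topology \<Rightarrow> ('g::topological_group_add \<Rightarrow> 'x \<Rightarrow> 'x) \<Rightarrow> ('x \<Rightarrow> real) \<Rightarrow> 'g \<Rightarrow> 'x \<Rightarrow> real" where
  "rtrans X act f g = (\<lambda>x\<in>topspace X. f (act g x))"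

definition RUC :: "'x topology \<Rightarrow> ('g::topological_group_add \<Rightarrow> 'x \<Rightarrow> 'x) \<Rightarrow> ('x \<Rightarrow> real) set" where
  "RUC X act =
     {f \<in> C_alg X. continuous_map euclidean (mtopology_of (C_metric X)) (\<lambda>g. rtrans X act f g)}"

definition G_subalgebra ::
  "'x topology \<Rightarrow> ('g::topological_group_add \<Rightarrow> 'x \<Rightarrow> 'x) \<Rightarrow> ('x \<Rightarrow> real) set \<Rightarrow> bool" where
  "G_subalgebra X act A \<longleftrightarrow>
     A \<subseteq> C_alg X \<and> closedin (mtopology_of (C_metric X)) A \<and>
     (\<lambda>x\<in>topspace X. 1) \<in> A \<and>
     (\<forall>f\<in>A. \<forall>c. (\<lambda>x\<in>topspace X. c * f x) \<in> A) \<and>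
     (\<forall>f\<in>A. \<forall>h\<in>A. (\<lambda>x\<in>topspace X. f x + h x) \<in> A) \<and>
     (\<forall>f\<in>A. \<forall>h\<in>A. (\<lambda>x\<in>topspace X. f x * h x) \<in> A) \<and>
     (\<forall>f\<in>A. \<forall>g. rtrans X act f g \<in> A)"

section \<open>Gelfand spaces\<close>

text \<open>The real characters of \<open>A\<close>, with the topology of pointwise convergence on \<open>A\<close>.\<close>

definition characters :: "'x topology \<Rightarrow> ('x \<Rightarrow> real) set \<Rightarrow> (('x \<Rightarrow> real) \<Rightarrow> real) set" where
  "characters X A = {\<phi> \<in> extensional A.
     \<phi> (\<lambda>x\<in>topspace X. 1) = 1 \<and>
     (\<forall>f\<in>A. \<forall>c. \<phi> (\<lambda>x\<in>topspace X. c * f x) = c * \<phi> f) \<and>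
     (\<forall>f\<in>A. \<forall>h\<in>A. \<phi> (\<lambda>x\<in>topspace X. f x + h x) = \<phi> f + \<phi> h) \<and>
     (\<forall>f\<in>A. \<forall>h\<in>A. \<phi> (\<lambda>x\<in>topspace X. f x * h x) = \<phi> f * \<phi> h)}"

definition gelfand :: "'x topology \<Rightarrow> ('x \<Rightarrow> real) set \<Rightarrow> (('x \<Rightarrow> real) \<Rightarrow> real) topology" where
  "gelfand X A = subtopology (product_topology (\<lambda>_. euclideanreal) A) (characters X A)"

definition gelfand_act ::
  "'x topology \<Rightarrow> ('g::topological_group_add \<Rightarrow> 'x \<Rightarrow> 'x) \<Rightarrow> ('x \<Rightarrow> real) set \<Rightarrow>
   'g \<Rightarrow> (('x \<Rightarrow> real) \<Rightarrow> real) \<Rightarrow> ('x \<Rightarrow> real) \<Rightarrow> real" where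
  "gelfand_act X act A g \<phi> = (\<lambda>f\<in>A. \<phi> (rtrans X act f g))"

definition gelfand_ev :: "('x \<Rightarrow> real) set \<Rightarrow> 'x \<Rightarrow> ('x \<Rightarrow> real) \<Rightarrow> real" where
  "gelfand_ev A x = (\<lambda>f\<in>A. f x)"

section \<open>SUC spaces and SUC functions\<close>

text \<open>
  Uniformities on \<open>topspace Y\<close> as filters, with the axioms of the class \<open>uniform_space\<close>
  (and its axiom \<open>open_uniformity\<close> for compatibility) relativised to the carrier.
\<close>

definition compatible_uniformity :: "'y topology \<Rightarrow> ('y \<times> 'y) filter \<Rightarrow> bool" where
  "compatible_uniformity Y \<U> \<longleftrightarrow>
     \<U> \<le> principal (topspace Y \<times> topspace Y) \<and>
     (\<forall>E. eventually E \<U> \<longrightarrow> (\<forall>y\<in>topspace Y. E (y, y))) \<and>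
     (\<forall>E. eventually E \<U> \<longrightarrow> eventually (\<lambda>(x, y). E (y, x)) \<U>) \<and>
     (\<forall>E. eventually E \<U> \<longrightarrow>
        (\<exists>D. eventually D \<U> \<and> (\<forall>x y z. D (x, y) \<longrightarrow> D (y, z) \<longrightarrow> E (x, z)))) \<and>
     (\<forall>U. U \<subseteq> topspace Y \<longrightarrow>
        (openin Y U \<longleftrightarrow> (\<forall>x\<in>U. eventually (\<lambda>(x', y). x' = x \<longrightarrow> y \<in> U) \<U>)))"

text \<open>Unique existence for compact Hausdorff \<open>Y\<close> is \<open>compact_Hausdorff_uniformity\<close> below.\<close>

definition compact_uniformity :: "'y topology \<Rightarrow> ('y \<times> 'y) filter" where
  "compact_uniformity Y = (THE \<U>. compatible_uniformity Y \<U>)"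

definition SUC_space :: "'y topology \<Rightarrow> ('g::topological_group_add \<Rightarrow> 'y \<Rightarrow> 'y) \<Rightarrow> bool" where
  "SUC_space Y act \<longleftrightarrow> compact_G_space Y act \<and>
     (\<forall>y0\<in>topspace Y. \<forall>\<epsilon>. eventually \<epsilon> (compact_uniformity Y) \<longrightarrow>
        (\<forall>\<^sub>F u in nhds 0. \<forall>g. \<epsilon> (act g (act u y0), act g y0)))"

definition SUC_compactification ::
  "'x topology \<Rightarrow> ('g::topological_group_add \<Rightarrow> 'x \<Rightarrow> 'x) \<Rightarrow>
   'y topology \<Rightarrow> ('g \<Rightarrow> 'y \<Rightarrow> 'y) \<Rightarrow> ('x \<Rightarrow> 'y) \<Rightarrow> bool" where
  "SUC_compactification X actX Y actY \<nu> \<longleftrightarrow>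
     G_compactification X actX Y actY \<nu> \<and> SUC_space Y actY"

text \<open>
  The existential over all compactifications has to range over spaces \<open>Y\<close> on one fixed type.
  The type \<open>('x \<Rightarrow> real) \<Rightarrow> real\<close> is large enough to carry a copy of every
  compactification of \<open>X\<close>; the lemma \<open>SUC_I\<close> below shows that a compactification on any
  other type yields the same functions.
\<close>

definition SUC :: "'x topology \<Rightarrow> ('g::topological_group_add \<Rightarrow> 'x \<Rightarrow> 'x) \<Rightarrow> ('x \<Rightarrow> real) set" where
  "SUC X act = {f \<in> C_alg X.
     \<exists>(Y :: (('x \<Rightarrow> real) \<Rightarrow> real) topology) actY \<nu> F.
       SUC_compactification X act Y actY \<nu> \<and> continuous_map Y euclideanreal F \<and>
       (\<forall>x\<in>topspace X. f x = F (\<nu> x))}"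

text \<open>
  Maximality among the SUC-compactifications on spaces of type \<open>'z\<close>; a statement quantifying
  over all of them leaves \<open>'z\<close> as a type variable.
\<close>

definition maximal_SUC_compactification ::
  "'z itself \<Rightarrow> 'x topology \<Rightarrow> ('g::topological_group_add \<Rightarrow> 'x \<Rightarrow> 'x) \<Rightarrow>
   'y topology \<Rightarrow> ('g \<Rightarrow> 'y \<Rightarrow> 'y) \<Rightarrow> ('x \<Rightarrow> 'y) \<Rightarrow> bool" where
  "maximal_SUC_compactification _ X actX Y actY \<nu> \<longleftrightarrow>
     SUC_compactification X actX Y actY \<nu> \<and>
     (\<forall>(Z :: 'z topology) actZ \<nu>'. SUC_compactification X actX Z actZ \<nu>' \<longrightarrow>
        (\<exists>\<alpha>. G_map Y actY Z actZ \<alpha> \<and> (\<forall>x\<in>topspace X. \<nu>' x = \<alpha> (\<nu> x))))"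

section \<open>The cyclic spaces\<close>

definition shift_space :: "real \<Rightarrow> ('g::topological_group_add \<Rightarrow> real) topology" where
  "shift_space r = product_topology (\<lambda>_. top_of_set {- r..r}) UNIV"

definition shift_act :: "'g::topological_group_add \<Rightarrow> ('g \<Rightarrow> real) \<Rightarrow> 'g \<Rightarrow> real" where
  "shift_act g \<omega> = (\<lambda>h. \<omega> (h + g))"

definition sharp :: "('g::topological_group_add \<Rightarrow> 'x \<Rightarrow> 'x) \<Rightarrow> ('x \<Rightarrow> real) \<Rightarrow> 'x \<Rightarrow> 'g \<Rightarrow> real" where
  "sharp act f x = (\<lambda>g. f (act g x))"

definition cyclic_space ::
  "'x topology \<Rightarrow> ('g::topological_group_add \<Rightarrow> 'x \<Rightarrow> 'x) \<Rightarrow> ('x \<Rightarrow> real) \<Rightarrow> ('g \<Rightarrow> real) topology" where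
  "cyclic_space X act f =
     subtopology (shift_space (sup_norm X f))
       (shift_space (sup_norm X f) closure_of (sharp act f ` topspace X))"

section \<open>Point-universality and semigroup compactifications\<close>

definition orbit_closure ::
  "'x topology \<Rightarrow> ('g::topological_group_add \<Rightarrow> 'x \<Rightarrow> 'x) \<Rightarrow> 'x \<Rightarrow> 'x set" where
  "orbit_closure X act x = X closure_of (range (\<lambda>g. act g x))"

definition point_universal_system ::
  "'x topology \<Rightarrow> ('g::topological_group_add \<Rightarrow> 'x \<Rightarrow> 'x) \<Rightarrow> 'x \<Rightarrow> bool" where
  "point_universal_system X act x0 \<longleftrightarrow>
     compact_G_space X act \<and> x0 \<in> topspace X \<and> orbit_closure X act x0 = topspace X \<and>
     (\<forall>x\<in>topspace X. \<exists>\<alpha>.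
        G_map X act (subtopology X (orbit_closure X act x)) act \<alpha> \<and> \<alpha> x0 = x)"

definition point_universal_algebra :: "('g::topological_group_add \<Rightarrow> real) set \<Rightarrow> bool" where
  "point_universal_algebra A \<longleftrightarrow>
     G_subalgebra euclidean (+) A \<and> A \<subseteq> RUC euclidean (+) \<and>
     point_universal_system (gelfand euclidean A) (gelfand_act euclidean (+) A) (gelfand_ev A 0)"

definition right_topological_semigroup_compactification ::
  "'s topology \<Rightarrow> ('g::topological_group_add \<Rightarrow> 's \<Rightarrow> 's) \<Rightarrow> ('s \<Rightarrow> 's \<Rightarrow> 's) \<Rightarrow> ('g \<Rightarrow> 's) \<Rightarrow> bool" where
  "right_topological_semigroup_compactification S act mul \<nu> \<longleftrightarrow>
     G_compactification euclidean (+) S act \<nu> \<and>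
     (\<forall>s\<in>topspace S. \<forall>t\<in>topspace S. mul s t \<in> topspace S) \<and>
     (\<forall>s\<in>topspace S. \<forall>t\<in>topspace S. \<forall>p\<in>topspace S. mul (mul s t) p = mul s (mul t p)) \<and>
     (\<forall>p\<in>topspace S. continuous_map S S (\<lambda>s. mul s p)) \<and>
     (\<forall>g h. \<nu> (g + h) = mul (\<nu> g) (\<nu> h))"

section \<open>The uniformity of a compact Hausdorff space\<close>

definition diag_nbhd :: "'y topology \<Rightarrow> ('y \<times> 'y) set \<Rightarrow> bool" where
  "diag_nbhd Y W \<longleftrightarrow> openin (prod_topology Y Y) W \<and> (\<forall>y\<in>topspace Y. (y, y) \<in> W)"

definition diag_filter :: "'y topology \<Rightarrow> ('y \<times> 'y) filter" where
  "diag_filter Y = (INF W\<in>Collect (diag_nbhd Y). principal W)"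

lemma eventually_diag_filter:
  "eventually E (diag_filter Y) \<longleftrightarrow> (\<exists>W. diag_nbhd Y W \<and> (\<forall>p\<in>W. E p))"
proof -
  have "diag_nbhd Y (topspace Y \<times> topspace Y)"
    by (auto simp: diag_nbhd_def openin_prod_Times_iff)
  then have ne: "Collect (diag_nbhd Y) \<noteq> {}" by blast
  have "\<exists>W\<in>Collect (diag_nbhd Y). principal W \<le> inf (principal A) (principal B)"
    if "A \<in> Collect (diag_nbhd Y)" "B \<in> Collect (diag_nbhd Y)" for A B
    using that by (intro bexI[of _ "A \<inter> B"]) (auto simp: diag_nbhd_def)
  then have "eventually E (diag_filter Y) \<longleftrightarrow>
      (\<exists>W\<in>Collect (diag_nbhd Y). eventually E (principal W))"
    unfolding diag_filter_def using ne by (intro eventually_INF_base) auto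
  then show ?thesis by (auto simp: eventually_principal)
qed

lemma diag_nbhd_square:
  assumes "diag_nbhd Y W" "y \<in> topspace Y"
  obtains N where "openin Y N" "y \<in> N" "N \<times> N \<subseteq> W"
proof -
  obtain A B where "openin Y A" "openin Y B" "y \<in> A" "y \<in> B" "A \<times> B \<subseteq> W"
    using assms unfolding diag_nbhd_def openin_prod_topology_alt by metis
  then show thesis by (intro that[of "A \<inter> B"]) auto
qed

lemma diag_nbhd_refine:
  assumes "compact_space Y" "Hausdorff_space Y" "diag_nbhd Y W"
  obtains V where "diag_nbhd Y V" "\<And>x y z. (x, y) \<in> V \<Longrightarrow> (y, z) \<in> V \<Longrightarrow> (x, z) \<in> W"
proof -
  have reg: "regular_space Y"
    using assms compact_Hausdorff_imp_regular_space by blast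
  have "\<forall>x\<in>topspace Y. \<exists>A C U. openin Y A \<and> closedin Y C \<and> openin Y U \<and> x \<in> A \<and> A \<subseteq> C \<and>
      C \<subseteq> U \<and> U \<times> U \<subseteq> W"
  proof
    fix x assume x: "x \<in> topspace Y"
    obtain U where U: "openin Y U" "x \<in> U" "U \<times> U \<subseteq> W"
      using diag_nbhd_square[OF assms(3) x] .
    obtain A C where "openin Y A" "closedin Y C" "x \<in> A" "A \<subseteq> C" "C \<subseteq> U"
      using reg U unfolding neighbourhood_base_of_closedin[symmetric] neighbourhood_base_of
      by (metis)
    then show "\<exists>A C U. openin Y A \<and> closedin Y C \<and> openin Y U \<and> x \<in> A \<and> A \<subseteq> C \<and>
      C \<subseteq> U \<and> U \<times> U \<subseteq> W" using U by blast
  qed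
  then obtain A C U where ACU: "\<And>x. x \<in> topspace Y \<Longrightarrow> openin Y (A x) \<and> closedin Y (C x) \<and>
      openin Y (U x) \<and> x \<in> A x \<and> A x \<subseteq> C x \<and> C x \<subseteq> U x \<and> U x \<times> U x \<subseteq> W"
    by metis
  have "\<exists>\<F>. finite \<F> \<and> \<F> \<subseteq> A ` topspace Y \<and> topspace Y \<subseteq> \<Union>\<F>"
    using assms(1) ACU by (intro compactinD) (auto simp: compact_space_def)
  then obtain K where K: "finite K" "K \<subseteq> topspace Y" "topspace Y \<subseteq> \<Union>(A ` K)"
    by (metis finite_subset_image)
  define P where "P x = U x \<times> U x \<union> (topspace Y - C x) \<times> (topspace Y - C x)" for x
  define V where "V = \<Inter>(insert (topspace Y \<times> topspace Y) (P ` K))"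
  have opP: "openin (prod_topology Y Y) (P x)" if "x \<in> K" for x
  proof -
    have "closedin Y (C x)" "openin Y (U x)" using that K ACU by blast+
    then have "openin Y (topspace Y - C x)" "openin Y (U x)" by blast+
    then show ?thesis
      unfolding P_def by (intro openin_Un) (simp_all add: openin_prod_Times_iff)
  qed
  have "openin (prod_topology Y Y) V"
    unfolding V_def using opP K(1) by (intro openin_Inter) (auto simp: openin_prod_Times_iff)
  moreover have "(y, y) \<in> V" if "y \<in> topspace Y" for y
  proof -
    have "(y, y) \<in> P k" if "k \<in> K" for k
    proof (cases "y \<in> C k")
      case True
      then have "y \<in> U k" using ACU[of k] that K(2) by blast
      then show ?thesis by (simp add: P_def)
    next
      case False
      then show ?thesis using \<open>y \<in> topspace Y\<close> by (simp add: P_def)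
    qed
    then show ?thesis using that by (simp add: V_def)
  qed
  ultimately have 1: "diag_nbhd Y V" by (auto simp: diag_nbhd_def)
  have 2: "(x, z) \<in> W" if xy: "(x, y) \<in> V" and yz: "(y, z) \<in> V" for x y z
  proof -
    have "y \<in> topspace Y" using xy by (auto simp: V_def)
    then obtain k where k: "k \<in> K" "y \<in> A k" using K by blast
    have "(x, y) \<in> P k" "(y, z) \<in> P k" using xy yz k by (auto simp: V_def)
    moreover have "y \<in> C k" using k ACU K by blast
    ultimately have "x \<in> U k" "z \<in> U k" by (auto simp: P_def)
    then show ?thesis using ACU[of k] k K by blast
  qed
  show thesis using that 1 2 by blast
qed

lemma compatible_diag_filter:
  assumes "compact_space Y" "Hausdorff_space Y"
  shows "compatible_uniformity Y (diag_filter Y)"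
  unfolding compatible_uniformity_def
proof (intro conjI allI impI ballI)
  show "diag_filter Y \<le> principal (topspace Y \<times> topspace Y)"
    unfolding le_principal eventually_diag_filter
    by (intro exI[of _ "topspace Y \<times> topspace Y"]) (auto simp: diag_nbhd_def openin_prod_Times_iff)
next
  fix E y assume "eventually E (diag_filter Y)" "y \<in> topspace Y"
  then show "E (y, y)" by (auto simp: eventually_diag_filter diag_nbhd_def)
next
  fix E assume "eventually E (diag_filter Y)"
  then obtain W where W: "diag_nbhd Y W" "\<forall>p\<in>W. E p" by (auto simp: eventually_diag_filter)
  have "continuous_map (prod_topology Y Y) (prod_topology Y Y) (\<lambda>p. (snd p, fst p))"
    by (intro continuous_map_pairedI continuous_map_fst continuous_map_snd)
  then have "openin (prod_topology Y Y) {p \<in> topspace (prod_topology Y Y). (snd p, fst p) \<in> W}"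
    using W by (intro openin_continuous_map_preimage) (auto simp: diag_nbhd_def)
  then have "diag_nbhd Y {p \<in> topspace (prod_topology Y Y). (snd p, fst p) \<in> W}"
    using W by (auto simp: diag_nbhd_def)
  then show "\<forall>\<^sub>F (x, y) in diag_filter Y. E (y, x)"
    unfolding eventually_diag_filter using W(2) by (intro exI conjI) (assumption, auto)
next
  fix E assume "eventually E (diag_filter Y)"
  then obtain W where W: "diag_nbhd Y W" "\<forall>p\<in>W. E p" by (auto simp: eventually_diag_filter)
  obtain V where V: "diag_nbhd Y V" "\<And>x y z. (x, y) \<in> V \<Longrightarrow> (y, z) \<in> V \<Longrightarrow> (x, z) \<in> W"
    using diag_nbhd_refine[OF assms W(1)] by blast
  show "\<exists>D. eventually D (diag_filter Y) \<and> (\<forall>x y z. D (x, y) \<longrightarrow> D (y, z) \<longrightarrow> E (x, z))"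
    unfolding eventually_diag_filter
    by (intro exI[of _ "\<lambda>p. p \<in> V"]) (use V W in blast)
next
  fix U assume U: "U \<subseteq> topspace Y"
  show "openin Y U \<longleftrightarrow> (\<forall>x\<in>U. \<forall>\<^sub>F (x', y) in diag_filter Y. x' = x \<longrightarrow> y \<in> U)"
  proof (intro iffI ballI)
    fix x assume op: "openin Y U" and x: "x \<in> U"
    have "closedin Y {x}"
      using assms(2) x U by (auto simp: closedin_Hausdorff_singleton)
    then have "openin Y (topspace Y - {x})" by blast
    then have "openin (prod_topology Y Y) (topspace Y \<times> U \<union> (topspace Y - {x}) \<times> topspace Y)"
      using op by (intro openin_Un) (simp_all add: openin_prod_Times_iff)
    then have "diag_nbhd Y (topspace Y \<times> U \<union> (topspace Y - {x}) \<times> topspace Y)"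
      using x by (auto simp: diag_nbhd_def)
    then show "\<forall>\<^sub>F (x', y) in diag_filter Y. x' = x \<longrightarrow> y \<in> U"
      unfolding eventually_diag_filter by (intro exI conjI) (assumption, auto)
  next
    assume *: "\<forall>x\<in>U. \<forall>\<^sub>F (x', y) in diag_filter Y. x' = x \<longrightarrow> y \<in> U"
    show "openin Y U"
    proof (subst openin_subopen, intro ballI)
      fix x assume x: "x \<in> U"
      then obtain W where W: "diag_nbhd Y W" "\<forall>(x', y)\<in>W. x' = x \<longrightarrow> y \<in> U"
        using * by (auto simp: eventually_diag_filter)
      obtain N where "openin Y N" "x \<in> N" "N \<times> N \<subseteq> W"
        using diag_nbhd_square[OF W(1)] x U by blast
      then show "\<exists>T. openin Y T \<and> x \<in> T \<and> T \<subseteq> U" using W(2) by blast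
    qed
  qed
qed

lemma compatible_uniformityD:
  assumes "compatible_uniformity Y \<U>"
  shows "\<forall>\<^sub>F p in \<U>. p \<in> topspace Y \<times> topspace Y"
    and "\<And>E y. eventually E \<U> \<Longrightarrow> y \<in> topspace Y \<Longrightarrow> E (y, y)"
    and "\<And>E. eventually E \<U> \<Longrightarrow> eventually (\<lambda>p. E (snd p, fst p)) \<U>"
    and "\<And>E. eventually E \<U> \<Longrightarrow>
        \<exists>D. eventually D \<U> \<and> (\<forall>x y z. D (x, y) \<longrightarrow> D (y, z) \<longrightarrow> E (x, z))"
    and "\<And>U. U \<subseteq> topspace Y \<Longrightarrow>
        openin Y U \<longleftrightarrow> (\<forall>x\<in>U. eventually (\<lambda>p. fst p = x \<longrightarrow> snd p \<in> U) \<U>)"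
  using assms unfolding compatible_uniformity_def le_principal case_prod_beta' by blast+

lemma uniformity_ball_interior:
  assumes "compatible_uniformity Y \<U>" "eventually E \<U>" "x \<in> topspace Y"
  obtains N where "openin Y N" "x \<in> N" "\<And>y. y \<in> N \<Longrightarrow> E (x, y)"
proof -
  note u = compatible_uniformityD[OF assms(1)]
  define N where "N = {y \<in> topspace Y. \<forall>\<^sub>F p in \<U>. fst p = y \<longrightarrow> E (x, snd p)}"
  have "\<forall>\<^sub>F p in \<U>. fst p = y \<longrightarrow> snd p \<in> N" if y: "y \<in> N" for y
  proof -
    have "eventually (\<lambda>p. fst p = y \<longrightarrow> E (x, snd p)) \<U>" using y by (simp add: N_def)
    from u(4)[OF this] obtain D where D: "eventually D \<U>"
      "\<And>a b c. D (a, b) \<Longrightarrow> D (b, c) \<Longrightarrow> a = y \<Longrightarrow> E (x, c)"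
      by auto
    show ?thesis using u(1) D(1)
    proof eventually_elim
      case (elim p)
      obtain a b where p: "p = (a, b)" by (cases p)
      have "b \<in> N" if "a = y"
      proof -
        have "\<forall>\<^sub>F q in \<U>. fst q = b \<longrightarrow> E (x, snd q)"
          using D(1)
        proof eventually_elim
          case (elim q)
          show ?case
          proof
            assume "fst q = b"
            then have "D (b, snd q)" using elim by (cases q) simp
            then show "E (x, snd q)" using D(2)[of a b "snd q"] \<open>D p\<close> p that by simp
          qed
        qed
        then show ?thesis using elim p by (simp add: N_def)
      qed
      then show ?case using p by simp
    qed
  qed
  moreover have NY: "N \<subseteq> topspace Y" by (auto simp: N_def)
  ultimately have "openin Y N" using u(5)[OF NY] by blast
  moreover have "x \<in> N"
  proof -
    have "\<forall>\<^sub>F p in \<U>. fst p = x \<longrightarrow> E (x, snd p)"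
      using assms(2) by eventually_elim auto
    then show ?thesis using assms(3) by (simp add: N_def)
  qed
  moreover have "E (x, y)" if "y \<in> N" for y
    using u(2)[of "\<lambda>p. fst p = y \<longrightarrow> E (x, snd p)" y] that by (simp add: N_def)
  ultimately show thesis using that by blast
qed

lemma compatible_uniformity_unique:
  assumes "compact_space Y" "compatible_uniformity Y \<U>"
  shows "\<U> = diag_filter Y"
proof (rule filter_eq_iff[THEN iffD2], intro allI iffI)
  note u = compatible_uniformityD[OF assms(2)]
  fix E assume E: "eventually E \<U>"
  from u(4)[OF E] obtain D where D: "eventually D \<U>" "\<And>x y z. D (x, y) \<Longrightarrow> D (y, z) \<Longrightarrow> E (x, z)"
    by auto
  have D': "eventually (\<lambda>p. D p \<and> D (snd p, fst p)) \<U>"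
    using D(1) u(3)[OF D(1)] by (rule eventually_conj)
  define W where "W = \<Union>{N \<times> N |N. openin Y N \<and> (\<forall>a\<in>N. \<forall>b\<in>N. E (a, b))}"
  have W1: "(x, x) \<in> W" if x: "x \<in> topspace Y" for x
  proof -
    obtain N where N: "openin Y N" "x \<in> N" "\<And>y. y \<in> N \<Longrightarrow> D (x, y) \<and> D (snd (x, y), fst (x, y))"
      using uniformity_ball_interior[OF assms(2) D' x] by blast
    have "E (a, b)" if "a \<in> N" "b \<in> N" for a b
      using D(2)[of a x b] N(3)[OF that(1)] N(3)[OF that(2)] by simp
    then show ?thesis using N(1,2) unfolding W_def by blast
  qed
  have "openin (prod_topology Y Y) W"
    unfolding W_def by (rule openin_Union) (auto simp: openin_prod_Times_iff)
  then have "diag_nbhd Y W" using W1 by (simp add: diag_nbhd_def)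
  then show "eventually E (diag_filter Y)"
    unfolding eventually_diag_filter by (intro exI[of _ W]) (auto simp: W_def)
next
  note u = compatible_uniformityD[OF assms(2)]
  fix E assume "eventually E (diag_filter Y)"
  then obtain W where W: "diag_nbhd Y W" "\<forall>p\<in>W. E p" by (auto simp: eventually_diag_filter)
  have "\<exists>D N. eventually D \<U> \<and> openin Y N \<and> x \<in> N \<and> (\<forall>a\<in>N. \<forall>b. D (a, b) \<longrightarrow> (a, b) \<in> W)"
    if x: "x \<in> topspace Y" for x
  proof -
    obtain M where M: "openin Y M" "x \<in> M" "M \<times> M \<subseteq> W"
      using diag_nbhd_square[OF W(1) x] .
    have "\<forall>\<^sub>F p in \<U>. fst p = x \<longrightarrow> snd p \<in> M"
      using u(5)[OF openin_subset[OF M(1)]] M(1,2) by blast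
    from u(4)[OF this] obtain D where D: "eventually D \<U>"
      "\<And>b c. D (x, b) \<Longrightarrow> D (b, c) \<Longrightarrow> c \<in> M"
      by auto
    obtain N where N: "openin Y N" "x \<in> N" "\<And>y. y \<in> N \<Longrightarrow> D (x, y)"
      using uniformity_ball_interior[OF assms(2) D(1) x] by blast
    have "(a, b) \<in> W" if a: "a \<in> N" and ab: "D (a, b)" for a b
    proof -
      have "D (a, a)" using u(2)[OF D(1)] openin_subset[OF N(1)] a by blast
      then have "a \<in> M" "b \<in> M" using D(2)[of a a] D(2)[of a b] N(3)[OF a] ab by auto
      then show ?thesis using M(3) by blast
    qed
    then show ?thesis using D(1) N(1,2) by blast
  qed
  then obtain D N where DN: "\<And>x. x \<in> topspace Y \<Longrightarrow> eventually (D x) \<U> \<and> openin Y (N x) \<and>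
      x \<in> N x \<and> (\<forall>a\<in>N x. \<forall>b. D x (a, b) \<longrightarrow> (a, b) \<in> W)"
    by metis
  have "\<exists>\<F>. finite \<F> \<and> \<F> \<subseteq> N ` topspace Y \<and> topspace Y \<subseteq> \<Union>\<F>"
    using assms(1) DN by (intro compactinD) (auto simp: compact_space_def)
  then obtain K where K: "finite K" "K \<subseteq> topspace Y" "topspace Y \<subseteq> \<Union>(N ` K)"
    by (metis finite_subset_image)
  have "\<forall>\<^sub>F p in \<U>. \<forall>k\<in>K. D k p"
    using K DN by (intro eventually_ball_finite) auto
  then show "eventually E \<U>" using u(1)
  proof eventually_elim
    case (elim p)
    then obtain a b where p: "p = (a, b)" "a \<in> topspace Y" by auto
    then obtain k where k: "k \<in> K" "a \<in> N k" using K by blast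
    then have "D k (a, b)" "k \<in> topspace Y" using elim p K by auto
    then have "(a, b) \<in> W" using DN[of k] k by blast
    then show ?case using W(2) p by simp
  qed
qed

lemma compact_Hausdorff_uniformity:
  assumes "compact_space Y" "Hausdorff_space Y"
  shows "\<exists>!\<U>. compatible_uniformity Y \<U>" "compact_uniformity Y = diag_filter Y"
proof -
  show *: "\<exists>!\<U>. compatible_uniformity Y \<U>"
    using compatible_diag_filter[OF assms] compatible_uniformity_unique[OF assms(1)] by blast
  show "compact_uniformity Y = diag_filter Y"
    unfolding compact_uniformity_def
    using the1_equality[OF * compatible_diag_filter[OF assms]] .
qed

section \<open>Independence of the type carrying the compactification\<close>

lemma SUC_compactification_transport:
  fixes Y :: "'y topology" and Z :: "'z topology"
  assumes S: "SUC_compactification X actX Y actY \<nu>" and h: "homeomorphic_maps Y Z e k"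
  shows "SUC_compactification X actX Z (\<lambda>g z. e (actY g (k z))) (e \<circ> \<nu>)"
proof -
  let ?act = "\<lambda>g z. e (actY g (k z))"
  have ce: "continuous_map Y Z e" and ck: "continuous_map Z Y k"
    and ke: "\<And>y. y \<in> topspace Y \<Longrightarrow> k (e y) = y" and ek: "\<And>z. z \<in> topspace Z \<Longrightarrow> e (k z) = z"
    using h by (auto simp: homeomorphic_maps_def)
  have YZ: "Y homeomorphic_space Z" using h by (auto simp: homeomorphic_space_def)
  have hm: "homeomorphic_map Y Z e" using h homeomorphic_map_maps by blast
  have ke': "k z \<in> topspace Y" if "z \<in> topspace Z" for z
    using ck that continuous_map_image_subset_topspace by blast
  from S have cY: "compact_space Y" and HY: "Hausdorff_space Y" and crY: "completely_regular_space Y"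
    and a0: "\<And>y. y \<in> topspace Y \<Longrightarrow> actY 0 y = y"
    and aa: "\<And>g h y. y \<in> topspace Y \<Longrightarrow> actY (g + h) y = actY g (actY h y)"
    and ca: "continuous_map (prod_topology euclidean Y) Y (\<lambda>(g, y). actY g y)"
    and c\<nu>: "continuous_map X Y \<nu>"
    and eq: "\<And>g x. x \<in> topspace X \<Longrightarrow> \<nu> (actX g x) = actY g (\<nu> x)"
    and dense: "Y closure_of (\<nu> ` topspace X) = topspace Y"
    by (auto simp: SUC_compactification_def G_compactification_def compact_G_space_def
        G_space_def continuous_action_def G_map_def)
  have cl: "actY g y \<in> topspace Y" if "y \<in> topspace Y" for g y
    using ca that continuous_map_image_subset_topspace by fastforce
  have \<nu>Y: "\<nu> x \<in> topspace Y" if "x \<in> topspace X" for x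
    using c\<nu> that continuous_map_image_subset_topspace by blast
  have cZ: "compact_space Z" and HZ: "Hausdorff_space Z" and crZ: "completely_regular_space Z"
    using YZ cY HY crY homeomorphic_compact_space homeomorphic_Hausdorff_space
      homeomorphic_completely_regular_space by blast+
  have "continuous_map (prod_topology euclidean Z) Z
      (e \<circ> ((\<lambda>(g, y). actY g y) \<circ> (\<lambda>p. (fst p, k (snd p)))))"
    using ce ca ck
    by (intro continuous_map_compose[OF _ ce] continuous_map_compose[OF _ ca]
        continuous_map_pairedI continuous_map_fst continuous_map_compose[OF continuous_map_snd ck, unfolded o_def])
  then have "continuous_map (prod_topology euclidean Z) Z (\<lambda>(g, z). ?act g z)"
    by (simp add: o_def case_prod_beta')
  then have GZ: "compact_G_space Z ?act"
    using cZ HZ crZ a0 aa ke ek ke' cl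
    by (auto simp: compact_G_space_def G_space_def continuous_action_def)
  have "Z closure_of (e ` (\<nu> ` topspace X)) = topspace Z"
    using homeomorphic_map_closure_of[OF hm, of "\<nu> ` topspace X"] dense \<nu>Y
      homeomorphic_imp_surjective_map[OF hm] by auto
  then have "G_compactification X actX Z ?act (e \<circ> \<nu>)"
    using GZ eq c\<nu> ce ke \<nu>Y
    by (auto simp: G_compactification_def G_map_def image_comp intro: continuous_map_compose)
  moreover have "SUC_space Z ?act"
    unfolding SUC_space_def compact_Hausdorff_uniformity(2)[OF cZ HZ]
  proof (intro conjI GZ ballI allI impI)
    fix z \<epsilon> assume z: "z \<in> topspace Z" and "eventually \<epsilon> (diag_filter Z)"
    then obtain W where W: "diag_nbhd Z W" "\<forall>p\<in>W. \<epsilon> p" by (auto simp: eventually_diag_filter)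
    have "continuous_map (prod_topology Y Y) (prod_topology Z Z) (\<lambda>p. (e (fst p), e (snd p)))"
      by (intro continuous_map_pairedI continuous_map_compose[OF continuous_map_fst ce, unfolded o_def]
          continuous_map_compose[OF continuous_map_snd ce, unfolded o_def])
    then have "openin (prod_topology Y Y)
        {p \<in> topspace (prod_topology Y Y). (e (fst p), e (snd p)) \<in> W}"
      using W by (intro openin_continuous_map_preimage) (auto simp: diag_nbhd_def)
    moreover have "e y \<in> topspace Z" if "y \<in> topspace Y" for y
      using ce that continuous_map_image_subset_topspace by blast
    ultimately have "diag_nbhd Y {p \<in> topspace (prod_topology Y Y). (e (fst p), e (snd p)) \<in> W}"
      using W by (auto simp: diag_nbhd_def)
    then have "eventually (\<lambda>p. \<epsilon> (e (fst p), e (snd p))) (compact_uniformity Y)"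
      unfolding compact_Hausdorff_uniformity(2)[OF cY HY] eventually_diag_filter
      using W(2) by (intro exI conjI) (assumption, auto)
    then have "\<forall>\<^sub>F u in nhds 0. \<forall>g. \<epsilon> (e (actY g (actY u (k z))), e (actY g (k z)))"
      using S ke'[OF z] unfolding SUC_compactification_def SUC_space_def by fastforce
    then show "\<forall>\<^sub>F u in nhds 0. \<forall>g. \<epsilon> (?act g (?act u z), ?act g z)"
      by eventually_elim (simp add: ke cl ke' z)
  qed
  ultimately show ?thesis by (simp add: SUC_compactification_def)
qed

lemma homeomorphic_copy:
  assumes "inj_on e (topspace Y)"
  shows "\<exists>Z k. homeomorphic_maps Y Z e k"
proof -
  define k where "k = inv_into (topspace Y) e"
  define Z where "Z = pullback_topology (e ` topspace Y) k Y"
  have k: "k (e y) = y" if "y \<in> topspace Y" for y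
    using assms that by (simp add: k_def)
  have "continuous_map Z Y k"
    unfolding Z_def using continuous_map_pullback[OF continuous_map_id, of "e ` topspace Y" k Y]
    by simp
  moreover have "continuous_map Y Z e"
    unfolding Z_def
  proof (rule continuous_map_pullback')
    show "continuous_map Y Y (k \<circ> e)"
      using k by (intro continuous_map_eq[OF continuous_map_id]) auto
  qed auto
  moreover have "topspace Z = e ` topspace Y"
    unfolding Z_def topspace_pullback_topology using k by auto
  ultimately have "homeomorphic_maps Y Z e k"
    using k by (auto simp: homeomorphic_maps_def)
  then show ?thesis by blast
qed

lemma SUC_I:
  fixes X :: "'x topology" and Y :: "'y topology"
  assumes f: "f \<in> C_alg X" and S: "SUC_compactification X actX Y actY \<nu>"
    and F: "continuous_map Y euclideanreal F" and fF: "\<And>x. x \<in> topspace X \<Longrightarrow> f x = F (\<nu> x)"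
  shows "f \<in> SUC X actX"
proof -
  define e :: "'y \<Rightarrow> ('x \<Rightarrow> real) \<Rightarrow> real" where
    "e = (\<lambda>y \<phi>. if \<exists>H. continuous_map Y euclideanreal H \<and> \<phi> = (\<lambda>x\<in>topspace X. H (\<nu> x)) \<and> H y = 0
                then 1 else 0)"
  have cr: "completely_regular_space Y" and HY: "Hausdorff_space Y"
    and dense: "Y closure_of (\<nu> ` topspace X) = topspace Y"
    using S by (auto simp: SUC_compactification_def G_compactification_def compact_G_space_def G_space_def)
  have "inj_on e (topspace Y)"
  proof (rule inj_onI, rule ccontr)
    fix y z assume y: "y \<in> topspace Y" and z: "z \<in> topspace Y" and eq: "e y = e z" and "y \<noteq> z"
    have "closedin Y {z}" using HY z by (simp add: closedin_Hausdorff_singleton)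
    then obtain H where H: "continuous_map Y (top_of_set {0..1::real}) H" "H y = 0" "H z = 1"
      using cr y \<open>y \<noteq> z\<close> unfolding completely_regular_space_def by (metis Diff_iff image_subset_iff singleton_iff)
    have cH: "continuous_map Y euclideanreal H" using H(1) by (simp add: continuous_map_in_subtopology)
    let ?\<phi> = "\<lambda>x\<in>topspace X. H (\<nu> x)"
    have "e y ?\<phi> = 1" unfolding e_def using cH H(2) by auto
    then have "e z ?\<phi> = 1" using eq by simp
    then obtain H' where H': "continuous_map Y euclideanreal H'"
      "?\<phi> = (\<lambda>x\<in>topspace X. H' (\<nu> x))" "H' z = 0"
      unfolding e_def by (metis zero_neq_one)
    have "H (\<nu> x) = H' (\<nu> x)" if "x \<in> topspace X" for x
      using fun_cong[OF H'(2), of x] that by simp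
    then have "H z = H' z"
      using forall_in_closure_of_eq[OF _ Hausdorff_space_euclidean cH H'(1), of z "\<nu> ` topspace X"]
        dense z by auto
    then show False using H(3) H'(3) by simp
  qed
  then obtain Z k where hom: "homeomorphic_maps Y Z e k" using homeomorphic_copy by blast
  have "continuous_map Z euclideanreal (F \<circ> k)"
    using hom F by (auto simp: homeomorphic_maps_def intro: continuous_map_compose)
  moreover have "f x = (F \<circ> k) ((e \<circ> \<nu>) x)" if "x \<in> topspace X" for x
  proof -
    have "\<nu> x \<in> topspace Y"
      using S that by (auto simp: SUC_compactification_def G_compactification_def G_map_def continuous_map_def)
    then show ?thesis using hom fF that by (simp add: homeomorphic_maps_def)
  qed
  ultimately show ?thesis
    unfolding SUC_def using f SUC_compactification_transport[OF S hom] by blast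
qed

end

theory Submission
  imports Defs
begin

text \<open>
  For a compact space the SUC condition only needs to be tested on a family of continuous functions
  separating points. It therefore passes to products, to closed invariant subsets and to images, and
  a diagonal map into a product of SUC systems gives one SUC-compactification $X \to Y$ through
  which all of $\mathrm{SUC}(X)$ factors. Then $\mathrm{SUC}(X)$ is the pullback of $C(Y)$ and its
  Gelfand space is $Y$. Every orbit closure in $G^{\mathrm{SUC}}$ is an SUC-compactification of $G$,
  so maximality gives point-universality, and point-universality gives the multiplication.
\<close>

section \<open>Actions and uniform estimates\<close>

text \<open>The obstacle is that every function in \<open>SUC X act\<close> comes with a
  compactification of its own, so sums, products and uniform limits have no evident common carrier.
  One witness is therefore chosen for each function, and all of them are multiplied together. This
  works for arbitrarily many factors because the neighbourhood in the SUC condition may depend on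
  the point: a function of one coordinate only asks for the condition at that coordinate, and
  compactness reduces every entourage to finitely many such functions. Closure under the operations
  and under uniform limits then becomes a fact about continuous functions on one compact space.

  The product lives on a larger type than the one fixed in the definition of \<open>SUC\<close>;
  \<open>SUC_I\<close> brings its functions back. The topology, the action and the SUC property of
  the Gelfand space are never checked on characters: every real character turns out to be evaluation
  at a point of Y, and everything is carried over along the resulting homeomorphism.\<close>

lemma compact_Hausdorff_imp_completely_regular_space:
  assumes "compact_space Y" "Hausdorff_space Y"
  shows "completely_regular_space Y"
  using assms compact_Hausdorff_or_regular_imp_normal_space normal_imp_completely_regular_space
  by blast

lemma compact_G_space_iff:
  "compact_G_space Y act \<longleftrightarrow> compact_space Y \<and> Hausdorff_space Y \<and> continuous_action Y act"
  using compact_Hausdorff_imp_completely_regular_space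
  by (auto simp: compact_G_space_def G_space_def)

lemma continuous_actionD:
  assumes "continuous_action X act"
  shows "\<And>x. x \<in> topspace X \<Longrightarrow> act 0 x = x"
    and "\<And>g h x. x \<in> topspace X \<Longrightarrow> act (g + h) x = act g (act h x)"
    and "\<And>g x. x \<in> topspace X \<Longrightarrow> act g x \<in> topspace X"
    and "\<And>g. continuous_map X X (act g)"
    and "\<And>x. x \<in> topspace X \<Longrightarrow> continuous_map euclidean X (\<lambda>g. act g x)"
proof -
  have c: "continuous_map (prod_topology euclidean X) X (\<lambda>(g, x). act g x)"
    using assms by (simp add: continuous_action_def)
  show 1: "continuous_map X X (act g)" for g
    using continuous_map_compose[OF continuous_map_pairedI[OF continuous_map_const[THEN iffD2] continuous_map_id] c, of g]
    by (simp add: o_def)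
  show "continuous_map euclidean X (\<lambda>g. act g x)" if "x \<in> topspace X" for x
    using continuous_map_compose[OF continuous_map_pairedI[OF continuous_map_id continuous_map_const[THEN iffD2]] c, of x]
      that by (simp add: o_def)
  show "act g x \<in> topspace X" if "x \<in> topspace X" for g x
    using 1 that continuous_map_image_subset_topspace by blast
qed (use assms in \<open>auto simp: continuous_action_def\<close>)

lemma compact_Hausdorff_separated:
  assumes "compact_space Y" "Hausdorff_space Y" "y \<in> topspace Y" "z \<in> topspace Y" "y \<noteq> z"
  obtains F where "continuous_map Y euclideanreal F" "F y \<noteq> F z"
proof -
  have "closedin Y {z}" using assms by (simp add: closedin_Hausdorff_singleton)
  then obtain H where H: "continuous_map Y (top_of_set {0..1::real}) H" "H y = 0" "H z = 1"
    using compact_Hausdorff_imp_completely_regular_space[OF assms(1,2)] assms(3,5)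
    unfolding completely_regular_space_def by (metis Diff_iff image_subset_iff singleton_iff)
  then show thesis
    using that[of H] by (simp add: continuous_map_in_subtopology)
qed

text \<open>
  A point-separating family generates the uniformity: the sets where one of its functions differs
  by more than a positive constant cover the compact complement of any neighbourhood of the diagonal.
\<close>

lemma diag_nbhd_separating:
  assumes "compact_space Y"
    and cont: "\<And>F. F \<in> \<F> \<Longrightarrow> continuous_map Y euclideanreal F"
    and sep: "\<And>y z. y \<in> topspace Y \<Longrightarrow> z \<in> topspace Y \<Longrightarrow> y \<noteq> z \<Longrightarrow> \<exists>F\<in>\<F>. F y \<noteq> F z"
    and W: "diag_nbhd Y W"
  obtains K e where "finite K" "K \<subseteq> \<F>" "(e::real) > 0"
    "\<And>y z. y \<in> topspace Y \<Longrightarrow> z \<in> topspace Y \<Longrightarrow>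
      \<forall>F\<in>K. \<bar>F y - F z\<bar> < e \<Longrightarrow> (y, z) \<in> W"
proof -
  let ?YY = "prod_topology Y Y"
  define U where "U = (\<lambda>(F, e::real). {p \<in> topspace ?YY. \<bar>F (fst p) - F (snd p)\<bar> \<in> {e<..}})"
  have op: "openin ?YY (U (F, e))" if "F \<in> \<F>" for F e
  proof -
    have "continuous_map ?YY euclideanreal (\<lambda>p. \<bar>F (fst p) - F (snd p)\<bar>)"
      using continuous_map_compose[OF continuous_map_fst cont[OF that]]
        continuous_map_compose[OF continuous_map_snd cont[OF that]]
      by (intro continuous_intros) (auto simp: o_def)
    from openin_continuous_map_preimage[OF this, of "{e<..}"] show ?thesis
      by (simp add: U_def)
  qed
  have "compact_space ?YY" using assms(1) by (simp add: compact_space_prod_topology)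
  moreover have "closedin ?YY (topspace ?YY - W)"
    using closedin_diff[OF closedin_topspace] W unfolding diag_nbhd_def by blast
  ultimately have "compactin ?YY (topspace ?YY - W)"
    using closedin_compact_space by blast
  moreover have "topspace ?YY - W \<subseteq> \<Union>(U ` (\<F> \<times> {0<..}))"
  proof
    fix p assume p: "p \<in> topspace ?YY - W"
    obtain y z where yz: "p = (y, z)" "y \<in> topspace Y" "z \<in> topspace Y" using p by auto
    have "y \<noteq> z" using p yz W by (auto simp: diag_nbhd_def)
    then obtain F where F: "F \<in> \<F>" "F y \<noteq> F z" using sep yz by blast
    then have "p \<in> U (F, \<bar>F y - F z\<bar> / 2)" using yz by (auto simp: U_def)
    then show "p \<in> \<Union>(U ` (\<F> \<times> {0<..}))" using F by force
  qed
  moreover have "openin ?YY V" if "V \<in> U ` (\<F> \<times> {0<..})" for V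
    using that op by auto
  ultimately obtain \<V> where "finite \<V>" "\<V> \<subseteq> U ` (\<F> \<times> {0<..})" "topspace ?YY - W \<subseteq> \<Union>\<V>"
    using compactinD[of ?YY "topspace ?YY - W" "U ` (\<F> \<times> {0<..})"] by auto
  then obtain D where D: "finite D" "D \<subseteq> \<F> \<times> {0<..}" "topspace ?YY - W \<subseteq> \<Union>(U ` D)"
    by (metis finite_subset_image)
  \<comment> \<open>The 1 only serves the case of empty \<open>D\<close>, where \<open>W\<close> is
    the whole square.\<close>
  define e where "e = Min (insert 1 (snd ` D))"
  show thesis
  proof (rule that)
    show "finite (fst ` D)" "fst ` D \<subseteq> \<F>" using D by auto
    show "e > 0" unfolding e_def using D by (subst Min_gr_iff) auto
    fix y z assume yz: "y \<in> topspace Y" "z \<in> topspace Y"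
      and small: "\<forall>F\<in>fst ` D. \<bar>F y - F z\<bar> < e"
    show "(y, z) \<in> W"
    proof (rule ccontr)
      assume "(y, z) \<notin> W"
      then obtain F d where Fd: "(F, d) \<in> D" "(y, z) \<in> U (F, d)" using D(3) yz by fastforce
      then have "e \<le> d" unfolding e_def using D(1) by (intro Min_le) force+
      then show False using small Fd by (force simp: U_def)
    qed
  qed
qed

text \<open>The pairs on which F varies by less than e form an open neighbourhood of the diagonal,
  hence an entourage. Together with the converse that follows, this replaces uniformities by real
  estimates in the rest of the proof.\<close>

lemma SUC_spaceD:
  assumes S: "SUC_space Y act" and F: "continuous_map Y euclideanreal F"
    and y: "y \<in> topspace Y" and e: "(e::real) > 0"
  shows "\<forall>\<^sub>F u in nhds 0. \<forall>g. \<bar>F (act g (act u y)) - F (act g y)\<bar> < e"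
proof -
  have Y: "compact_space Y" "Hausdorff_space Y"
    using S by (auto simp: SUC_space_def compact_G_space_iff)
  let ?YY = "prod_topology Y Y"
  have "continuous_map ?YY euclideanreal (\<lambda>p. \<bar>F (fst p) - F (snd p)\<bar>)"
    using continuous_map_compose[OF continuous_map_fst F] continuous_map_compose[OF continuous_map_snd F]
    by (intro continuous_intros) (auto simp: o_def)
  from openin_continuous_map_preimage[OF this, of "{..<e}"]
  have "diag_nbhd Y {p \<in> topspace ?YY. \<bar>F (fst p) - F (snd p)\<bar> < e}"
    using e by (simp add: diag_nbhd_def)
  then have "eventually (\<lambda>p. \<bar>F (fst p) - F (snd p)\<bar> < e) (compact_uniformity Y)"
    unfolding compact_Hausdorff_uniformity(2)[OF Y] eventually_diag_filter by blast
  then show ?thesis using S y unfolding SUC_space_def by fastforce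
qed

text \<open>An entourage is controlled by finitely many members of the family and one common e, and
  finitely many neighbourhoods of 0 can be intersected.\<close>

lemma SUC_space_separatingI:
  assumes Y: "compact_G_space Y act"
    and cont: "\<And>F. F \<in> \<F> \<Longrightarrow> continuous_map Y euclideanreal F"
    and sep: "\<And>y z. y \<in> topspace Y \<Longrightarrow> z \<in> topspace Y \<Longrightarrow> y \<noteq> z \<Longrightarrow> \<exists>F\<in>\<F>. F y \<noteq> F z"
    and SUC: "\<And>F y e. F \<in> \<F> \<Longrightarrow> y \<in> topspace Y \<Longrightarrow> (e::real) > 0 \<Longrightarrow>
      \<forall>\<^sub>F u in nhds 0. \<forall>g. \<bar>F (act g (act u y)) - F (act g y)\<bar> < e"
  shows "SUC_space Y act"
proof -
  have Y': "compact_space Y" "Hausdorff_space Y" "continuous_action Y act"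
    using Y by (auto simp: compact_G_space_iff)
  show ?thesis
    unfolding SUC_space_def compact_Hausdorff_uniformity(2)[OF Y'(1,2)]
  proof (intro conjI Y ballI allI impI)
    fix y \<epsilon> assume y: "y \<in> topspace Y" and "eventually \<epsilon> (diag_filter Y)"
    then obtain W where W: "diag_nbhd Y W" "\<forall>p\<in>W. \<epsilon> p" by (auto simp: eventually_diag_filter)
    obtain K e where K: "finite K" "K \<subseteq> \<F>" "(e::real) > 0" and
      KW: "\<And>y z. y \<in> topspace Y \<Longrightarrow> z \<in> topspace Y \<Longrightarrow>
        \<forall>F\<in>K. \<bar>F y - F z\<bar> < e \<Longrightarrow> (y, z) \<in> W"
      by (rule diag_nbhd_separating[of Y \<F> W, OF Y'(1) cont sep W(1)]) blast+
    have "\<forall>\<^sub>F u in nhds 0. \<forall>F\<in>K. \<forall>g. \<bar>F (act g (act u y)) - F (act g y)\<bar> < e"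
      using K SUC y by (intro eventually_ball_finite) auto
    then show "\<forall>\<^sub>F u in nhds 0. \<forall>g. \<epsilon> (act g (act u y), act g y)"
    proof eventually_elim
      case (elim u)
      show ?case
      proof
        fix g
        have "(act g (act u y), act g y) \<in> W"
          using elim by (intro KW continuous_actionD(3)[OF Y'(3)] y) auto
        then show "\<epsilon> (act g (act u y), act g y)" using W(2) by blast
      qed
    qed
  qed
qed

section \<open>Permanence properties of SUC spaces\<close>

text \<open>
  Joint continuity of the action on the image is inherited because the product of the
  perfect surjection \<open>\<pi>\<close> with the identity of the group is again a quotient map.
\<close>

lemma SUC_space_image:
  assumes S: "SUC_space Y actY" and c: "continuous_map Y Z \<pi>"
    and onto: "\<pi> ` topspace Y = topspace Z" and Z: "Hausdorff_space Z"
    and eq: "\<And>g y. y \<in> topspace Y \<Longrightarrow> \<pi> (actY g y) = actZ g (\<pi> y)"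
  shows "SUC_space Z actZ"
proof -
  have Y: "compact_space Y" "Hausdorff_space Y" and aY: "continuous_action Y actY"
    using S by (auto simp: SUC_space_def compact_G_space_iff)
  note act = continuous_actionD[OF aY]
  have cZ: "compact_space Z"
    using image_compactin[OF _ c, of "topspace Y"] Y(1) onto by (simp add: compact_space_def)
  have "perfect_map Y Z \<pi>"
    using c onto continuous_imp_proper_map[OF Y(1) _ c] Z Hausdorff_imp_kc_space
    by (auto simp: perfect_map_def)
  then have p: "proper_map (prod_topology euclidean Y) (prod_topology euclidean Z) (\<lambda>(g, y). (id g, \<pi> y))"
    by (intro proper_map_prod[THEN iffD2] disjI2 conjI proper_map_id) (simp add: perfect_map_def)
  have "continuous_map (prod_topology euclidean Y) (prod_topology euclidean Z) (\<lambda>(g, y). (id g, \<pi> y))"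
    using continuous_map_compose[OF continuous_map_snd c]
    by (auto simp: case_prod_beta' o_def intro!: continuous_map_pairedI continuous_map_fst)
  with p have "perfect_map (prod_topology euclidean Y) (prod_topology euclidean Z) (\<lambda>(g, y). (id g, \<pi> y))"
    using onto by (force simp: perfect_map_def image_def)
  then have q: "quotient_map (prod_topology euclidean Y) (prod_topology euclidean Z) (\<lambda>(g, y). (id g, \<pi> y))"
    by (rule perfect_imp_quotient_map)
  have "continuous_map (prod_topology euclidean Y) Z (\<pi> \<circ> (\<lambda>(g, y). actY g y))"
    using aY c continuous_map_compose by (auto simp: continuous_action_def)
  then have "continuous_map (prod_topology euclidean Y) Z
      ((\<lambda>(g, z). actZ g z) \<circ> (\<lambda>(g, y). (id g, \<pi> y)))"
    by (rule continuous_map_eq) (auto simp: eq)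
  from continuous_compose_quotient_map[OF q this]
  have "continuous_map (prod_topology euclidean Z) Z (\<lambda>(g, z). actZ g z)" .
  moreover have "actZ 0 z = z" "actZ (g + h) z = actZ g (actZ h z)" if z: "z \<in> topspace Z" for g h z
  proof -
    obtain y where y: "y \<in> topspace Y" "z = \<pi> y" using z onto by blast
    have "\<pi> (actY 0 y) = actZ 0 (\<pi> y)" "\<pi> (actY (g + h) y) = actZ (g + h) (\<pi> y)"
      "\<pi> (actY g (actY h y)) = actZ g (actZ h (\<pi> y))"
      using y(1) by (simp_all add: eq act(3))
    then show "actZ 0 z = z" "actZ (g + h) z = actZ g (actZ h z)"
      using y act(1,2) by auto
  qed
  ultimately have GZ: "compact_G_space Z actZ"
    using cZ Z by (simp add: compact_G_space_iff continuous_action_def)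
  show ?thesis
  proof (rule SUC_space_separatingI[OF GZ, of "{F. continuous_map Z euclideanreal F}"])
    fix z z' assume "z \<in> topspace Z" "z' \<in> topspace Z" "z \<noteq> z'"
    then show "\<exists>F\<in>{F. continuous_map Z euclideanreal F}. F z \<noteq> F z'"
      using compact_Hausdorff_separated[OF cZ Z] by (metis mem_Collect_eq)
  next
    fix F z and e :: real
    assume F: "F \<in> {F. continuous_map Z euclideanreal F}" and z: "z \<in> topspace Z" and e: "e > 0"
    \<comment> \<open>By equivariance the estimate for F at z is the estimate for F composed with
      \<open>\<pi>\<close> at any preimage y.\<close>
    obtain y where y: "y \<in> topspace Y" "z = \<pi> y" using z onto by blast
    have "\<forall>\<^sub>F u in nhds 0. \<forall>g. \<bar>(F \<circ> \<pi>) (actY g (actY u y)) - (F \<circ> \<pi>) (actY g y)\<bar> < e"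
      using F c by (intro SUC_spaceD[OF S _ y(1) e] continuous_map_compose[of Y Z]) auto
    then show "\<forall>\<^sub>F u in nhds 0. \<forall>g. \<bar>F (actZ g (actZ u z)) - F (actZ g z)\<bar> < e"
      by (simp add: y eq act(3))
  qed auto
qed

text \<open>Functions depending on a single coordinate already separate the points of the product,
  and for them the SUC estimate is the one in that factor. Uniformity over infinitely many
  coordinates never arises.\<close>

lemma SUC_space_product:
  assumes S: "\<And>i. i \<in> I \<Longrightarrow> SUC_space (Y i) (act i)"
  shows "SUC_space (product_topology Y I) (\<lambda>g p. \<lambda>i\<in>I. act i g (p i))"
proof -
  let ?P = "product_topology Y I"
  let ?act = "\<lambda>g p. \<lambda>i\<in>I. act i g (p i)"
  have Y: "compact_space (Y i)" "Hausdorff_space (Y i)" "continuous_action (Y i) (act i)" if "i \<in> I" for i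
    using S[OF that] by (auto simp: SUC_space_def compact_G_space_iff)
  note act = continuous_actionD[OF Y(3)]
  have pr: "continuous_map ?P (Y i) (\<lambda>p. p i)" if "i \<in> I" for i
    using that by (rule continuous_map_product_projection)
  have pi: "p i \<in> topspace (Y i)" if "p \<in> topspace ?P" "i \<in> I" for p i
    using that by auto
  have "continuous_map (prod_topology euclidean ?P) ?P (\<lambda>(g, p). ?act g p)"
    unfolding continuous_map_componentwise
  proof (intro conjI ballI)
    fix i assume i: "i \<in> I"
    have "continuous_map (prod_topology euclidean ?P) (prod_topology euclidean (Y i)) (\<lambda>x. (fst x, snd x i))"
      using continuous_map_compose[OF continuous_map_snd pr[OF i]]
      by (auto simp: o_def intro!: continuous_map_pairedI continuous_map_fst)
    moreover have "continuous_map (prod_topology euclidean (Y i)) (Y i) (\<lambda>(g, y). act i g y)"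
      using Y(3)[OF i] by (simp add: continuous_action_def)
    ultimately have "continuous_map (prod_topology euclidean ?P) (Y i)
        ((\<lambda>(g, y). act i g y) \<circ> (\<lambda>x. (fst x, snd x i)))"
      by (rule continuous_map_compose)
    then show "continuous_map (prod_topology euclidean ?P) (Y i) (\<lambda>x. (case x of (g, p) \<Rightarrow> ?act g p) i)"
      using i by (simp add: o_def case_prod_beta')
  qed auto
  moreover have "?act 0 p = p" if "p \<in> topspace ?P" for p
    using that act(1) pi[OF that] by (auto simp: fun_eq_iff PiE_def extensional_def)
  moreover have "?act (g + h) p = ?act g (?act h p)" if "p \<in> topspace ?P" for p g h
    using act(2) pi[OF that] by (auto simp: fun_eq_iff)
  ultimately have "compact_G_space ?P ?act"
    using Y by (auto simp: compact_G_space_iff continuous_action_def compact_space_product_topology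
        Hausdorff_space_product_topology)
  then show ?thesis
  proof (rule SUC_space_separatingI[where \<F> = "{F \<circ> (\<lambda>p. p i) |i F. i \<in> I \<and> continuous_map (Y i) euclideanreal F}"])
    fix F assume "F \<in> {F \<circ> (\<lambda>p. p i) |i F. i \<in> I \<and> continuous_map (Y i) euclideanreal F}"
    then show "continuous_map ?P euclideanreal F"
      using pr continuous_map_compose by blast
  next
    fix p q assume p: "p \<in> topspace ?P" and q: "q \<in> topspace ?P" and "p \<noteq> q"
    then obtain i where i: "i \<in> I" "p i \<noteq> q i"
      by (metis PiE_ext topspace_product_topology)
    then obtain F where "continuous_map (Y i) euclideanreal F" "F (p i) \<noteq> F (q i)"
      using compact_Hausdorff_separated[OF Y(1,2)] pi p q by metis
    then show "\<exists>F\<in>{F \<circ> (\<lambda>p. p i) |i F. i \<in> I \<and> continuous_map (Y i) euclideanreal F}. F p \<noteq> F q"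
      using i by (intro bexI[of _ "F \<circ> (\<lambda>p. p i)"]) auto
  next
    fix H p and e :: real
    assume "H \<in> {F \<circ> (\<lambda>p. p i) |i F. i \<in> I \<and> continuous_map (Y i) euclideanreal F}"
      and p: "p \<in> topspace ?P" and e: "e > 0"
    then obtain i F where i: "i \<in> I" "continuous_map (Y i) euclideanreal F" "H = F \<circ> (\<lambda>p. p i)"
      by blast
    show "\<forall>\<^sub>F u in nhds 0. \<forall>g. \<bar>H (?act g (?act u p)) - H (?act g p)\<bar> < e"
      using SUC_spaceD[OF S[OF i(1)] i(2) pi[OF p i(1)] e] i by simp
  qed
qed

text \<open>Each translation is continuous and maps the image of X into itself, so it preserves the
  closure of that image. The test functions are restrictions of continuous functions on P, which
  inherit their estimates from P.\<close>

lemma SUC_compactification_closure: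
  assumes S: "SUC_space P act" and \<nu>: "G_map X actX P act \<nu>" and X: "continuous_action X actX"
  shows "SUC_compactification X actX (subtopology P (P closure_of (\<nu> ` topspace X))) act \<nu>"
proof -
  let ?C = "P closure_of (\<nu> ` topspace X)"
  let ?Y = "subtopology P ?C"
  have P: "compact_space P" "Hausdorff_space P" "continuous_action P act"
    using S by (auto simp: SUC_space_def compact_G_space_iff)
  note aP = continuous_actionD[OF P(3)] and aX = continuous_actionD[OF X]
  have c\<nu>: "continuous_map X P \<nu>" and eq: "\<And>g x. x \<in> topspace X \<Longrightarrow> \<nu> (actX g x) = act g (\<nu> x)"
    using \<nu> by (auto simp: G_map_def)
  have \<nu>P: "\<nu> ` topspace X \<subseteq> topspace P"
    using c\<nu> by (rule continuous_map_image_subset_topspace)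
  have CP: "?C \<subseteq> topspace P" by (rule closure_of_subset_topspace)
  have \<nu>C: "\<nu> ` topspace X \<subseteq> ?C" using closure_of_subset[OF \<nu>P] .
  have inv: "act g y \<in> ?C" if "y \<in> ?C" for g y
  proof -
    have "act g ` ?C \<subseteq> P closure_of (act g ` \<nu> ` topspace X)"
      using aP(4) by (rule continuous_map_image_closure_subset)
    also have "act g ` \<nu> ` topspace X \<subseteq> \<nu> ` topspace X"
      using eq[symmetric] aX(3) by auto
    then have "P closure_of (act g ` \<nu> ` topspace X) \<subseteq> ?C" by (rule closure_of_mono)
    finally show ?thesis using that by blast
  qed
  have YC: "topspace ?Y = ?C" using CP by auto
  have cY: "compact_space ?Y"
    using closedin_compact_space[OF P(1)] by (simp add: compact_space_subtopology)
  have "continuous_map (prod_topology euclidean ?Y) P (\<lambda>(g, y). act g y)"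
  proof -
    have *: "prod_topology euclidean ?Y = subtopology (prod_topology euclidean P) (UNIV \<times> ?C)"
      by (simp add: prod_topology_subtopology)
    show ?thesis
      unfolding * using P(3) by (intro continuous_map_from_subtopology) (simp add: continuous_action_def)
  qed
  then have "continuous_map (prod_topology euclidean ?Y) ?Y (\<lambda>(g, y). act g y)"
    using inv YC by (auto simp: continuous_map_in_subtopology)
  then have GY: "compact_G_space ?Y act"
    using cY P(2) aP(1,2) CP
    by (auto simp: compact_G_space_iff continuous_action_def Hausdorff_space_subtopology)
  have "SUC_space ?Y act"
  proof (rule SUC_space_separatingI[OF GY, of "{F. continuous_map P euclideanreal F}"])
    fix y z assume "y \<in> topspace ?Y" "z \<in> topspace ?Y" "y \<noteq> z"
    then show "\<exists>F\<in>{F. continuous_map P euclideanreal F}. F y \<noteq> F z"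
      using compact_Hausdorff_separated[OF P(1,2), of y z] by (metis IntD1 mem_Collect_eq topspace_subtopology)
  next
    fix F y and e :: real
    assume "F \<in> {F. continuous_map P euclideanreal F}" "y \<in> topspace ?Y" "e > 0"
    then show "\<forall>\<^sub>F u in nhds 0. \<forall>g. \<bar>F (act g (act u y)) - F (act g y)\<bar> < e"
      using SUC_spaceD[OF S] by simp
  qed (simp add: continuous_map_from_subtopology)
  moreover have "continuous_map X ?Y \<nu>"
    using c\<nu> \<nu>C by (auto simp: continuous_map_in_subtopology)
  moreover have "?Y closure_of (\<nu> ` topspace X) = topspace ?Y"
    using \<nu>C CP by (simp add: closure_of_subtopology Int_absorb1 YC del: topspace_subtopology)
  ultimately show ?thesis
    using GY eq by (auto simp: SUC_compactification_def G_compactification_def G_map_def)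
qed

section \<open>The algebra of a compactification and its Gelfand space\<close>

lemma C_alg_iff:
  "f \<in> C_alg X \<longleftrightarrow>
    f \<in> extensional (topspace X) \<and> continuous_map X euclideanreal f \<and> bounded (f ` topspace X)"
  by (auto simp: C_alg_def C_metric_def Met_TC.mbounded_alt bounded_two_points)

lemma dist_le_mdist_C_metric:
  assumes "f \<in> C_alg X" "h \<in> C_alg X" "x \<in> topspace X"
  shows "\<bar>f x - h x\<bar> \<le> mdist (C_metric X) f h"
  using mdist_cfunspace_imp_mdist_le[of f X euclidean_metric h "mdist (C_metric X) f h" x] assms
  by (simp add: C_alg_def C_metric_def dist_real_def)

lemma mdist_C_metric_le:
  assumes "0 \<le> e" "\<And>x. x \<in> topspace X \<Longrightarrow> \<bar>f x - h x\<bar> \<le> e"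
  shows "mdist (C_metric X) f h \<le> e"
  using assms unfolding C_metric_def by (intro mdist_cfunspace_le) (auto simp: dist_real_def)

text \<open>The topological half of the argument: Y is recovered as the Gelfand space of the
  functions on X that extend continuously to Y. The action enters in a later context.\<close>

locale dense_compactification =
  fixes X :: "'x topology" and Y :: "'y topology" and \<nu> :: "'x \<Rightarrow> 'y"
  assumes compact: "compact_space Y" and Hausdorff: "Hausdorff_space Y"
    and continuous: "continuous_map X Y \<nu>"
    and dense: "Y closure_of (\<nu> ` topspace X) = topspace Y"
begin

definition pull :: "('y \<Rightarrow> real) \<Rightarrow> 'x \<Rightarrow> real" where
  "pull F = (\<lambda>x\<in>topspace X. F (\<nu> x))"

definition pull_alg :: "('x \<Rightarrow> real) set" where
  "pull_alg = pull ` {F. continuous_map Y euclideanreal F}"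

text \<open>Density determines the extension on \<open>topspace Y\<close>, but its values off the
  carrier are arbitrary, which is why it is picked by choice.\<close>

definition extension :: "('x \<Rightarrow> real) \<Rightarrow> 'y \<Rightarrow> real" where
  "extension f = (SOME F. continuous_map Y euclideanreal F \<and> pull F = f)"

definition point_char :: "'y \<Rightarrow> ('x \<Rightarrow> real) \<Rightarrow> real" where
  "point_char y = (\<lambda>f\<in>pull_alg. extension f y)"

lemma \<nu>_in: "x \<in> topspace X \<Longrightarrow> \<nu> x \<in> topspace Y"
  using continuous continuous_map_image_subset_topspace by blast

lemma pull_C_alg:
  assumes "continuous_map Y euclideanreal F"
  shows "pull F \<in> C_alg X"
proof -
  have "continuous_map X euclideanreal (F \<circ> \<nu>)"
    using continuous assms by (rule continuous_map_compose)
  then have "continuous_map X euclideanreal (pull F)"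
    by (rule continuous_map_eq) (simp add: pull_def)
  moreover have "compact (F ` topspace Y)"
    using image_compactin[OF _ assms, of "topspace Y"] compact by (simp add: compact_space_def)
  then have "bounded (pull F ` topspace X)"
    by (rule bounded_subset[OF compact_imp_bounded]) (auto simp: pull_def \<nu>_in)
  ultimately show ?thesis by (simp add: C_alg_iff pull_def)
qed

lemma pull_algI: "continuous_map Y euclideanreal F \<Longrightarrow> pull F \<in> pull_alg"
  by (simp add: pull_alg_def)

lemma pull_alg_subset_C_alg: "pull_alg \<subseteq> C_alg X"
  using pull_C_alg by (auto simp: pull_alg_def)

lemma abs_le_dense:
  assumes F: "continuous_map Y euclideanreal F"
    and le: "\<And>x. x \<in> topspace X \<Longrightarrow> \<bar>F (\<nu> x)\<bar> \<le> e" and y: "y \<in> topspace Y"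
  shows "\<bar>F y\<bar> \<le> e"
proof (rule forall_in_closure_of[of y Y "\<nu> ` topspace X"])
  have "continuous_map Y euclideanreal (\<lambda>y. \<bar>F y\<bar>)"
    using F by (intro continuous_intros)
  from closedin_continuous_map_preimage[OF this, of "{..e}"]
  show "closedin Y {y \<in> topspace Y. \<bar>F y\<bar> \<le> e}" by simp
qed (use y dense le in auto)

lemma pull_eqD:
  assumes "continuous_map Y euclideanreal F" "continuous_map Y euclideanreal H"
    and "pull F = pull H" "y \<in> topspace Y"
  shows "F y = H y"
proof (rule forall_in_closure_of_eq[of y Y "\<nu> ` topspace X"])
  fix z assume "z \<in> \<nu> ` topspace X"
  then obtain x where "x \<in> topspace X" "z = \<nu> x" by blast
  then show "F z = H z" using fun_cong[OF assms(3), of x] by (simp add: pull_def)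
qed (use assms dense in auto)

lemma extension:
  assumes "f \<in> pull_alg"
  shows "continuous_map Y euclideanreal (extension f)" "pull (extension f) = f"
proof -
  have "\<exists>F. continuous_map Y euclideanreal F \<and> pull F = f"
    using assms by (auto simp: pull_alg_def)
  from someI_ex[OF this] show "continuous_map Y euclideanreal (extension f)" "pull (extension f) = f"
    by (auto simp: extension_def)
qed

lemma extension_\<nu>:
  assumes "f \<in> pull_alg" "x \<in> topspace X"
  shows "extension f (\<nu> x) = f x"
  using fun_cong[OF extension(2)[OF assms(1)], of x] assms(2) by (simp add: pull_def)

lemma extension_pull:
  assumes "continuous_map Y euclideanreal F" "y \<in> topspace Y"
  shows "extension (pull F) y = F y"
  using assms pull_eqD extension[OF pull_algI] by blast

lemma point_char_pull:
  assumes "continuous_map Y euclideanreal F" "y \<in> topspace Y"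
  shows "point_char y (pull F) = F y"
  using assms by (simp add: point_char_def pull_algI extension_pull)

lemma pull_alg_operations:
  assumes "f \<in> pull_alg" "h \<in> pull_alg"
  shows "(\<lambda>x\<in>topspace X. 1) = pull (\<lambda>y. 1)"
    and "(\<lambda>x\<in>topspace X. c * f x) = pull (\<lambda>y. c * extension f y)"
    and "(\<lambda>x\<in>topspace X. f x + h x) = pull (\<lambda>y. extension f y + extension h y)"
    and "(\<lambda>x\<in>topspace X. f x * h x) = pull (\<lambda>y. extension f y * extension h y)"
  using assms by (auto simp: pull_def fun_eq_iff extension_\<nu>)

lemma pull_alg_closed_operations:
  assumes "f \<in> pull_alg" "h \<in> pull_alg"
  shows "(\<lambda>x\<in>topspace X. 1) \<in> pull_alg"
    and "(\<lambda>x\<in>topspace X. c * f x) \<in> pull_alg"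
    and "(\<lambda>x\<in>topspace X. f x + h x) \<in> pull_alg"
    and "(\<lambda>x\<in>topspace X. f x * h x) \<in> pull_alg"
  unfolding pull_alg_operations[OF assms]
  using extension(1)[OF assms(1)] extension(1)[OF assms(2)]
  by (intro pull_algI continuous_intros | simp)+

text \<open>A bound on the dense image of X holds on all of Y. Hence a sequence converging uniformly
  on X has uniformly Cauchy extensions, and their continuous limit on Y extends the given
  limit.\<close>

lemma closedin_pull_alg: "closedin (mtopology_of (C_metric X)) pull_alg"
proof -
  interpret Metric_space "C_alg X" "mdist (C_metric X)"
    using Metric_space_mspace_mdist[of "C_metric X"] by (simp only: C_alg_def)
  have mt: "mtopology_of (C_metric X) = mtopology" by (simp add: mtopology_of_def C_alg_def)
  show ?thesis
    unfolding mt metric_closedin_iff_sequentially_closed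
  proof (intro conjI pull_alg_subset_C_alg allI impI)
    fix \<sigma> l assume *: "range \<sigma> \<subseteq> pull_alg \<and> limitin mtopology \<sigma> l sequentially"
    then have \<sigma>: "\<sigma> n \<in> pull_alg" for n by auto
    have l: "l \<in> C_alg X" using * limitin_mspace by blast
    have close: "\<exists>N. \<forall>n\<ge>N. \<forall>x\<in>topspace X. \<bar>\<sigma> n x - l x\<bar> < e" if "e > 0" for e :: real
    proof -
      have "\<forall>e>0. \<exists>N. \<forall>n\<ge>N. \<sigma> n \<in> C_alg X \<and> mdist (C_metric X) (\<sigma> n) l < e"
        using conjunct2[OF *] unfolding limit_metric_sequentially by (rule conjunct2)
      from this[rule_format, OF that] obtain N where
        "\<forall>n\<ge>N. \<sigma> n \<in> C_alg X \<and> mdist (C_metric X) (\<sigma> n) l < e" ..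
      then have N: "mdist (C_metric X) (\<sigma> n) l < e" if "n \<ge> N" for n using that by simp
      have "\<bar>\<sigma> n x - l x\<bar> < e" if "n \<ge> N" "x \<in> topspace X" for n x
        using dist_le_mdist_C_metric[OF subsetD[OF pull_alg_subset_C_alg \<sigma>] l that(2)] N[OF that(1)]
        by (rule le_less_trans)
      then show ?thesis by (intro exI[of _ N] allI impI ballI)
    qed
    have Cauchy: "\<exists>N. \<forall>m n y. N \<le> m \<longrightarrow> N \<le> n \<longrightarrow> y \<in> topspace Y \<longrightarrow>
        dist (extension (\<sigma> m) y) (extension (\<sigma> n) y) < e" if e: "e > 0" for e :: real
    proof -
      obtain N where N: "\<And>n x. n \<ge> N \<Longrightarrow> x \<in> topspace X \<Longrightarrow> \<bar>\<sigma> n x - l x\<bar> < e / 3"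
        using close[of "e / 3"] e by auto
      \<comment> \<open>Density transfers only non-strict bounds; thirds leave room for the strict
        one.\<close>
      have "\<bar>extension (\<sigma> m) y - extension (\<sigma> n) y\<bar> \<le> e / 3 + e / 3"
        if mn: "N \<le> m" "N \<le> n" and y: "y \<in> topspace Y" for m n y
      proof (rule abs_le_dense[OF _ _ y])
        show "continuous_map Y euclideanreal (\<lambda>y. extension (\<sigma> m) y - extension (\<sigma> n) y)"
          using extension(1)[OF \<sigma>] by (intro continuous_intros) auto
        fix x assume x: "x \<in> topspace X"
        show "\<bar>extension (\<sigma> m) (\<nu> x) - extension (\<sigma> n) (\<nu> x)\<bar> \<le> e / 3 + e / 3"
          using N[OF mn(1) x] N[OF mn(2) x]
          unfolding extension_\<nu>[OF \<sigma> x] abs_le_iff abs_less_iff by linarith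
      qed
      then have "\<bar>extension (\<sigma> m) y - extension (\<sigma> n) y\<bar> < e"
        if "N \<le> m" "N \<le> n" "y \<in> topspace Y" for m n y
        using that e by fastforce
      then show ?thesis unfolding dist_real_def by (intro exI[of _ N]) blast
    qed
    have complete: "Met_TC.mcomplete TYPE(real)" by (simp add: complete_UNIV)
    have cont: "\<forall>\<^sub>F n in sequentially. continuous_map Y Met_TC.mtopology (extension (\<sigma> n))"
      using extension(1)[OF \<sigma>] by simp
    obtain G where cG: "continuous_map Y Met_TC.mtopology G" and
      lim: "\<And>e. 0 < e \<Longrightarrow> \<forall>\<^sub>F n in sequentially. \<forall>y\<in>topspace Y. dist (extension (\<sigma> n) y) (G y) < e"
      by (rule Met_TC.continuous_map_uniformly_Cauchy_limit[OF complete cont Cauchy]) (assumption, rule that)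
    from cG have G: "continuous_map Y euclideanreal G" by simp
    have "l x = G (\<nu> x)" if x: "x \<in> topspace X" for x
    proof (rule LIMSEQ_unique)
      show "(\<lambda>n. \<sigma> n x) \<longlonglongrightarrow> l x"
      proof (rule LIMSEQ_I)
        fix e :: real assume "e > 0"
        from close[OF this] show "\<exists>N. \<forall>n\<ge>N. norm (\<sigma> n x - l x) < e" using x by auto
      qed
      show "(\<lambda>n. \<sigma> n x) \<longlonglongrightarrow> G (\<nu> x)"
        unfolding tendsto_iff
      proof (intro allI impI)
        fix e :: real assume "e > 0"
        from lim[OF this] show "\<forall>\<^sub>F n in sequentially. dist (\<sigma> n x) (G (\<nu> x)) < e"
        proof eventually_elim
          case (elim n)
          then have "dist (extension (\<sigma> n) (\<nu> x)) (G (\<nu> x)) < e" using \<nu>_in[OF x] by (rule bspec)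
          then show ?case by (simp only: extension_\<nu>[OF \<sigma> x])
        qed
      qed
    qed
    then have "l = pull G"
      using l by (auto simp: pull_def fun_eq_iff C_alg_iff extensional_def)
    then show "l \<in> pull_alg" using G pull_algI by simp
  qed
qed

lemma point_char_\<nu>:
  assumes "x \<in> topspace X"
  shows "point_char (\<nu> x) = gelfand_ev pull_alg x"
  using assms by (auto simp: point_char_def gelfand_ev_def extension_\<nu>)

lemma point_char_in_characters:
  assumes y: "y \<in> topspace Y"
  shows "point_char y \<in> characters X pull_alg"
  unfolding characters_def
proof (intro CollectI conjI ballI allI)
  show "point_char y \<in> extensional pull_alg" by (simp add: point_char_def)
  have "pull (\<lambda>y. 1) = (\<lambda>x\<in>topspace X. 1)" by (simp add: pull_def)
  then show "point_char y (\<lambda>x\<in>topspace X. 1) = 1"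
    using point_char_pull[OF _ y, of "\<lambda>y. 1"] by simp
next
  fix f c assume f: "f \<in> pull_alg"
  show "point_char y (\<lambda>x\<in>topspace X. c * f x) = c * point_char y f"
    unfolding pull_alg_operations[OF f f] using extension(1)[OF f] f
    by (subst point_char_pull[OF _ y]) (auto simp: point_char_def intro!: continuous_intros)
next
  fix f h assume f: "f \<in> pull_alg" and h: "h \<in> pull_alg"
  show "point_char y (\<lambda>x\<in>topspace X. f x + h x) = point_char y f + point_char y h"
    "point_char y (\<lambda>x\<in>topspace X. f x * h x) = point_char y f * point_char y h"
    unfolding pull_alg_operations[OF f h] using extension(1)[OF f] extension(1)[OF h] f h
    by (subst point_char_pull[OF _ y]; auto simp: point_char_def intro!: continuous_intros)+
qed

text \<open>
  A sum of squares of functions killed by the character is killed as well. If the finitely many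
  functions had no common zero, this sum would be invertible in the algebra.
\<close>

lemma character_eq_point_char:
  assumes \<phi>: "\<phi> \<in> characters X pull_alg"
  obtains y where "y \<in> topspace Y" "\<phi> = point_char y"
proof -
  have \<phi>1: "\<phi> (\<lambda>x\<in>topspace X. 1) = 1"
    and \<phi>s: "\<And>f c. f \<in> pull_alg \<Longrightarrow> \<phi> (\<lambda>x\<in>topspace X. c * f x) = c * \<phi> f"
    and \<phi>a: "\<And>f h. f \<in> pull_alg \<Longrightarrow> h \<in> pull_alg \<Longrightarrow> \<phi> (\<lambda>x\<in>topspace X. f x + h x) = \<phi> f + \<phi> h"
    and \<phi>m: "\<And>f h. f \<in> pull_alg \<Longrightarrow> h \<in> pull_alg \<Longrightarrow> \<phi> (\<lambda>x\<in>topspace X. f x * h x) = \<phi> f * \<phi> h"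
    and \<phi>e: "\<phi> \<in> extensional pull_alg"
    using \<phi> by (auto simp: characters_def)
  have one: "continuous_map Y euclideanreal (\<lambda>y. 1)" by simp
  have p1: "\<phi> (pull (\<lambda>y. 1)) = 1" using \<phi>1 by (simp add: pull_def)
  have ps: "\<phi> (pull (\<lambda>y. c * F y)) = c * \<phi> (pull F)"
    if "continuous_map Y euclideanreal F" for F c
    using \<phi>s[OF pull_algI[OF that], of c] by (simp add: pull_def cong: restrict_cong)
  have pa: "\<phi> (pull (\<lambda>y. F y + H y)) = \<phi> (pull F) + \<phi> (pull H)"
    and pm: "\<phi> (pull (\<lambda>y. F y * H y)) = \<phi> (pull F) * \<phi> (pull H)"
    if "continuous_map Y euclideanreal F" "continuous_map Y euclideanreal H" for F H
    using \<phi>a[OF pull_algI[OF that(1)] pull_algI[OF that(2)]]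
      \<phi>m[OF pull_algI[OF that(1)] pull_algI[OF that(2)]]
    by (simp_all add: pull_def cong: restrict_cong)
  \<comment> \<open>Nonnegativity is carried through the induction because it makes the zeros of a
    sum common zeros of the summands.\<close>
  have sq: "\<exists>H. continuous_map Y euclideanreal H \<and> \<phi> (pull H) = 0 \<and>
      (\<forall>y\<in>topspace Y. H y \<ge> 0 \<and> (H y = 0 \<longrightarrow> (\<forall>f\<in>S. extension f y = \<phi> f)))"
    if "finite S" "S \<subseteq> pull_alg" for S
    using that
  proof (induction S rule: finite_induct)
    case empty
    show ?case using ps[OF one, of 0] by (intro exI[of _ "\<lambda>y. 0"]) simp
  next
    case (insert f S)
    then obtain H where H: "continuous_map Y euclideanreal H" "\<phi> (pull H) = 0"
      "\<And>y. y \<in> topspace Y \<Longrightarrow> H y \<ge> 0"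
      "\<And>y. y \<in> topspace Y \<Longrightarrow> H y = 0 \<Longrightarrow> \<forall>f\<in>S. extension f y = \<phi> f"
      by auto
    have f: "f \<in> pull_alg" using insert by simp
    \<comment> \<open>The constant is written as a multiple of 1 so that \<open>ps\<close> and
      \<open>p1\<close> evaluate it.\<close>
    define D where "D = (\<lambda>y. extension f y + (- \<phi> f) * 1)"
    have c: "continuous_map Y euclideanreal (\<lambda>y. (- \<phi> f) * 1)" by simp
    have D: "continuous_map Y euclideanreal D"
      unfolding D_def using extension(1)[OF f] by (intro continuous_intros) auto
    have "\<phi> (pull D) = \<phi> f + (- \<phi> f) * 1"
      unfolding D_def pa[OF extension(1)[OF f] c] ps[OF one] p1 extension(2)[OF f] ..
    then have "\<phi> (pull (\<lambda>y. D y * D y)) = 0" using pm[OF D D] by simp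
    moreover have DD: "continuous_map Y euclideanreal (\<lambda>y. D y * D y)"
      using D by (intro continuous_intros)
    ultimately have "\<phi> (pull (\<lambda>y. H y + D y * D y)) = 0" using pa[OF H(1) DD] H(2) by simp
    moreover have "continuous_map Y euclideanreal (\<lambda>y. H y + D y * D y)"
      using H(1) DD by (rule continuous_map_add)
    moreover have "H y + D y * D y \<ge> 0 \<and>
        (H y + D y * D y = 0 \<longrightarrow> (\<forall>f\<in>insert f S. extension f y = \<phi> f))" if y: "y \<in> topspace Y" for y
    proof -
      have "D y * D y \<ge> 0" by simp
      then have 0: "H y = 0 \<and> D y = 0" if "H y + D y * D y = 0"
        using H(3)[OF y] that by (simp add: add_nonneg_eq_0_iff)
      have "extension g y = \<phi> g" if "H y + D y * D y = 0" "g \<in> insert f S" for g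
      proof (cases "g = f")
        case True
        have "extension f y + (- \<phi> f) * 1 = 0" using 0[OF that(1)] by (simp only: D_def)
        then show ?thesis using True by simp
      next
        case False
        then show ?thesis using H(4)[OF y] 0[OF that(1)] that(2) by blast
      qed
      moreover have "H y + D y * D y \<ge> 0" using H(3)[OF y] by simp
      ultimately show ?thesis by blast
    qed
    ultimately show ?case by blast
  qed
  define Z where "Z f = {y \<in> topspace Y. extension f y \<in> {\<phi> f}}" for f
  \<comment> \<open>Finite intersection property: if the closed sets \<open>Z f\<close> had no
    common point, finitely many of them would have none, and the corresponding H would vanish
    nowhere.\<close>
  have "\<exists>y\<in>topspace Y. \<forall>f\<in>pull_alg. extension f y = \<phi> f"
  proof (rule ccontr)
    assume none: "\<not> ?thesis"
    have "openin Y (topspace Y - Z f)" if "f \<in> pull_alg" for f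
      unfolding Z_def by (intro openin_diff closedin_continuous_map_preimage[OF extension(1)[OF that]]) auto
    moreover have "topspace Y \<subseteq> \<Union>((\<lambda>f. topspace Y - Z f) ` pull_alg)"
      using none by (auto simp: Z_def)
    ultimately have "\<exists>\<F>. finite \<F> \<and> \<F> \<subseteq> (\<lambda>f. topspace Y - Z f) ` pull_alg \<and> topspace Y \<subseteq> \<Union>\<F>"
      using compact by (intro compactinD) (auto simp: compact_space_def)
    then obtain S where S: "finite S" "S \<subseteq> pull_alg" "topspace Y \<subseteq> \<Union>((\<lambda>f. topspace Y - Z f) ` S)"
      by (metis finite_subset_image)
    from sq[OF S(1,2)] obtain H where H: "continuous_map Y euclideanreal H" "\<phi> (pull H) = 0"
      "\<And>y. y \<in> topspace Y \<Longrightarrow> H y = 0 \<Longrightarrow> \<forall>f\<in>S. extension f y = \<phi> f"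
      by blast
    have nz: "H y \<noteq> 0" if "y \<in> topspace Y" for y
      using H(3)[OF that] S(3) that by (auto simp: Z_def)
    have inv: "continuous_map Y euclideanreal (\<lambda>y. inverse (H y))"
      using H(1) nz by (intro continuous_intros) auto
    have "pull (\<lambda>y. H y * inverse (H y)) = pull (\<lambda>y. 1)"
      using nz by (auto simp: pull_def fun_eq_iff \<nu>_in)
    then show False using pm[OF H(1) inv] H(2) p1 by simp
  qed
  then obtain y where y: "y \<in> topspace Y" "\<And>f. f \<in> pull_alg \<Longrightarrow> extension f y = \<phi> f" by blast
  have "\<phi> = point_char y"
    using y(2) \<phi>e by (auto simp: point_char_def fun_eq_iff extensional_def)
  then show thesis using that y(1) by blast
qed

lemma topspace_gelfand: "topspace (gelfand X pull_alg) = characters X pull_alg"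
  by (auto simp: gelfand_def characters_def PiE_def)

lemma Hausdorff_gelfand: "Hausdorff_space (gelfand X pull_alg)"
  by (simp add: gelfand_def Hausdorff_space_subtopology Hausdorff_space_product_topology)

text \<open>A continuous bijection from a compact space onto a Hausdorff space: continuous functions
  on Y separate its points, and every character is a point evaluation.\<close>

lemma homeomorphic_point_char: "homeomorphic_map Y (gelfand X pull_alg) point_char"
proof (rule continuous_imp_homeomorphic_map)
  show "continuous_map Y (gelfand X pull_alg) point_char"
    unfolding gelfand_def continuous_map_in_subtopology continuous_map_componentwise
    using extension(1) point_char_in_characters by (auto simp: point_char_def)
  show "point_char ` topspace Y = topspace (gelfand X pull_alg)"
    unfolding topspace_gelfand using character_eq_point_char point_char_in_characters by blast
  show "inj_on point_char (topspace Y)"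
  proof (rule inj_onI, rule ccontr)
    fix y z assume yz: "y \<in> topspace Y" "z \<in> topspace Y" "point_char y = point_char z" "y \<noteq> z"
    then obtain F where "continuous_map Y euclideanreal F" "F y \<noteq> F z"
      using compact_Hausdorff_separated[OF compact Hausdorff] by metis
    then show False using yz point_char_pull by metis
  qed
qed (rule compact Hausdorff_gelfand)+

end

section \<open>Compactifications and right uniformly continuous functions\<close>

lemma SUC_compactification_imp_dense:
  assumes "SUC_compactification X actX Y actY \<nu>"
  shows "dense_compactification X Y \<nu>"
  using assms
  by (auto simp: SUC_compactification_def G_compactification_def compact_G_space_iff G_map_def
      dense_compactification_def)

text \<open>Tube lemma: the open set of pairs where the difference stays below e contains the slice
  over \<open>g0\<close>, hence, Y being compact, a product of a neighbourhood of \<open>g0\<close>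
  with Y. This is the source of norm continuity in \<open>RUC\<close>.\<close>

lemma action_uniformly_continuous:
  fixes act :: "'g::topological_group_add \<Rightarrow> 'y \<Rightarrow> 'y"
  assumes Y: "compact_space Y" "continuous_action Y act"
    and F: "continuous_map Y euclideanreal F" and e: "(e::real) > 0"
  obtains U where "open U" "g0 \<in> U"
    "\<And>g y. g \<in> U \<Longrightarrow> y \<in> topspace Y \<Longrightarrow> \<bar>F (act g y) - F (act g0 y)\<bar> < e"
proof -
  let ?G = "euclidean :: 'g topology"
  have "continuous_map (prod_topology ?G Y) euclideanreal (F \<circ> (\<lambda>(g, y). act g y))"
    using F Y(2) by (auto simp: continuous_action_def intro: continuous_map_compose)
  moreover have "continuous_map (prod_topology ?G Y) euclideanreal ((F \<circ> act g0) \<circ> snd)"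
    using F continuous_actionD(4)[OF Y(2)] by (blast intro: continuous_map_compose continuous_map_snd)
  ultimately have "continuous_map (prod_topology ?G Y) euclideanreal
      (\<lambda>p. \<bar>F (act (fst p) (snd p)) - F (act g0 (snd p))\<bar>)"
    by (intro continuous_intros) (simp_all add: o_def case_prod_beta')
  from openin_continuous_map_preimage[OF this, of "{..<e}"]
  have W: "openin (prod_topology ?G Y)
      {p \<in> topspace (prod_topology ?G Y). \<bar>F (act (fst p) (snd p)) - F (act g0 (snd p))\<bar> < e}"
    by simp
  have "{g0} \<times> topspace Y \<subseteq>
      {p \<in> topspace (prod_topology ?G Y). \<bar>F (act (fst p) (snd p)) - F (act g0 (snd p))\<bar> < e}"
    using e by auto
  then obtain U V where UV: "openin ?G U" "g0 \<in> U" "topspace Y \<subseteq> V" "U \<times> V \<subseteq>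
      {p \<in> topspace (prod_topology ?G Y). \<bar>F (act (fst p) (snd p)) - F (act g0 (snd p))\<bar> < e}"
    using tube_lemma_right[OF W, of "topspace Y" g0] Y(1) unfolding compact_space_def by auto
  show thesis
  proof (rule that)
    show "open U" using UV(1) by simp
    fix g y assume "g \<in> U" "y \<in> topspace Y"
    then have "(g, y) \<in> U \<times> V" using UV(3) by blast
    then show "\<bar>F (act g y) - F (act g0 y)\<bar> < e" using UV(4) by fastforce
  qed (rule UV(2))
qed

context
  fixes X :: "'x topology" and actX :: "'g::topological_group_add \<Rightarrow> 'x \<Rightarrow> 'x"
    and Y :: "'y topology" and actY :: "'g \<Rightarrow> 'y \<Rightarrow> 'y" and \<nu> :: "'x \<Rightarrow> 'y"
  assumes X: "continuous_action X actX" and S: "SUC_compactification X actX Y actY \<nu>"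
begin

interpretation dense_compactification X Y \<nu>
  using S by (rule SUC_compactification_imp_dense)

private lemma Y: "SUC_space Y actY" "continuous_action Y actY"
  and equivariant: "\<And>g x. x \<in> topspace X \<Longrightarrow> \<nu> (actX g x) = actY g (\<nu> x)"
  using S by (auto simp: SUC_compactification_def G_compactification_def compact_G_space_iff G_map_def)

private lemma continuous_act:
  "continuous_map Y euclideanreal F \<Longrightarrow> continuous_map Y euclideanreal (\<lambda>y. F (actY g y))"
  using continuous_map_compose[OF continuous_actionD(4)[OF Y(2)], of euclideanreal F g] by (simp add: o_def)

lemma rtrans_pull: "rtrans X actX (pull F) g = pull (\<lambda>y. F (actY g y))"
  using continuous_actionD(3)[OF X] equivariant by (auto simp: rtrans_def pull_def)

lemma rtrans_pull_alg:
  assumes "f \<in> pull_alg"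
  shows "rtrans X actX f g = pull (\<lambda>y. extension f (actY g y))"
  using rtrans_pull[of "extension f"] extension(2)[OF assms] by simp

text \<open>Y may live on any type here, thanks to \<open>SUC_I\<close>. Both the universal
  compactification and maximality over all Z depend on this freedom.\<close>

lemma pull_alg_subset_SUC: "pull_alg \<subseteq> SUC X actX"
proof
  fix f assume f: "f \<in> pull_alg"
  show "f \<in> SUC X actX"
    using f pull_alg_subset_C_alg by (intro SUC_I[OF _ S extension(1)[OF f]]) (auto simp: extension_\<nu>)
qed

lemma pull_alg_subset_RUC: "pull_alg \<subseteq> RUC X actX"
proof
  fix f assume f: "f \<in> pull_alg"
  interpret M: Metric_space "mspace (C_metric X)" "mdist (C_metric X)" by simp
  have rt: "rtrans X actX f g \<in> C_alg X" for g
    unfolding rtrans_pull_alg[OF f] by (intro pull_C_alg continuous_act extension(1)[OF f])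
  have "continuous_map euclidean M.mtopology (\<lambda>g. rtrans X actX f g)"
    unfolding M.continuous_map_to_metric
  proof (intro ballI allI impI)
    fix g0 :: 'g and e :: real assume e: "e > 0"
    \<comment> \<open>Half of e, since a pointwise bound gives only a non-strict bound on the
      supremum distance.\<close>
    obtain U where U: "open U" "g0 \<in> U" and
      small: "\<And>g y. g \<in> U \<Longrightarrow> y \<in> topspace Y \<Longrightarrow>
        \<bar>extension f (actY g y) - extension f (actY g0 y)\<bar> < e / 2"
      by (rule action_uniformly_continuous[OF compact Y(2) extension(1)[OF f], of "e / 2" g0])
        (simp add: e, rule that)
    have "mdist (C_metric X) (rtrans X actX f g0) (rtrans X actX f g) < e" if g: "g \<in> U" for g
    proof -
      have "mdist (C_metric X) (rtrans X actX f g0) (rtrans X actX f g) \<le> e / 2"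
      proof (rule mdist_C_metric_le)
        fix x assume "x \<in> topspace X"
        then show "\<bar>rtrans X actX f g0 x - rtrans X actX f g x\<bar> \<le> e / 2"
          using small[OF g \<nu>_in, of x] unfolding rtrans_pull_alg[OF f]
          by (simp add: pull_def abs_minus_commute)
      qed (use e in simp)
      then show ?thesis using e by simp
    qed
    then show "\<exists>U. openin euclidean U \<and> g0 \<in> U \<and>
        (\<forall>g\<in>U. rtrans X actX f g \<in> M.mball (rtrans X actX f g0) e)"
      using U rt by (intro exI[of _ U]) (auto simp: M.in_mball C_alg_def)
  qed
  then show "f \<in> RUC X actX"
    using f pull_alg_subset_C_alg by (auto simp: RUC_def mtopology_of_def)
qed

lemma G_subalgebra_pull_alg: "G_subalgebra X actX pull_alg"
proof -
  have "rtrans X actX f g \<in> pull_alg" if "f \<in> pull_alg" for f g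
    unfolding rtrans_pull_alg[OF that] by (intro pull_algI continuous_act extension(1)[OF that])
  moreover have "(\<lambda>x\<in>topspace X. 1) \<in> pull_alg"
    using pull_algI[of "\<lambda>y. 1"] by (simp add: pull_def)
  ultimately show ?thesis
    using pull_alg_subset_C_alg closedin_pull_alg pull_alg_closed_operations
    by (simp add: G_subalgebra_def)
qed

text \<open>Both sides evaluate at y the extension of the translated function, which is the
  translate of the extension.\<close>

lemma point_char_equivariant:
  assumes y: "y \<in> topspace Y"
  shows "point_char (actY g y) = gelfand_act X actX pull_alg g (point_char y)"
proof
  fix f
  show "point_char (actY g y) f = gelfand_act X actX pull_alg g (point_char y) f"
  proof (cases "f \<in> pull_alg")
    case True
    then show ?thesis
      using point_char_pull[OF continuous_act[OF extension(1)[OF True]] y]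
      by (simp add: gelfand_act_def rtrans_pull_alg) (simp add: point_char_def)
  qed (simp add: point_char_def gelfand_act_def)
qed

text \<open>The Gelfand space is an equivariant image of Y, so joint continuity of its action and
  the SUC condition both come from \<open>SUC_space_image\<close>.\<close>

lemma SUC_compactification_gelfand_pull_alg:
  "SUC_compactification X actX (gelfand X pull_alg) (gelfand_act X actX pull_alg) (gelfand_ev pull_alg)"
proof -
  let ?\<Gamma> = "gelfand X pull_alg" and ?act = "gelfand_act X actX pull_alg" and ?ev = "gelfand_ev pull_alg"
  note h = homeomorphic_point_char
  have c: "continuous_map Y ?\<Gamma> point_char" and onto: "point_char ` topspace Y = topspace ?\<Gamma>"
    using h homeomorphic_imp_continuous_map homeomorphic_imp_surjective_map by blast+
  have "SUC_space ?\<Gamma> ?act"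
    by (rule SUC_space_image[OF Y(1) c onto Hausdorff_gelfand]) (rule point_char_equivariant)
  moreover have "continuous_map X ?\<Gamma> ?ev"
    using continuous_map_compose[OF continuous c]
    by (rule continuous_map_eq) (simp add: point_char_\<nu>)
  moreover have "?ev (actX g x) = ?act g (?ev x)" if "x \<in> topspace X" for g x
    using that point_char_equivariant[OF \<nu>_in[OF that], of g] continuous_actionD(3)[OF X that]
    by (simp flip: point_char_\<nu> add: equivariant)
  moreover have "?ev ` topspace X = point_char ` \<nu> ` topspace X"
    by (auto simp: point_char_\<nu> image_iff)
  then have "?\<Gamma> closure_of (?ev ` topspace X) = topspace ?\<Gamma>"
    using homeomorphic_map_closure_of[OF h, of "\<nu> ` topspace X"] dense \<nu>_in onto by auto
  ultimately show ?thesis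
    by (auto simp: SUC_compactification_def G_compactification_def G_map_def SUC_space_def)
qed

text \<open>Restricting characters from A to \<open>pull_alg\<close> is an equivariant continuous
  map; the inverse of \<open>point_char\<close> then leads into Y. This is the factor map behind
  maximality.\<close>

lemma G_map_from_gelfand:
  assumes A: "pull_alg \<subseteq> A"
  obtains \<alpha> where "G_map (gelfand X A) (gelfand_act X actX A) Y actY \<alpha>"
    "\<And>x. x \<in> topspace X \<Longrightarrow> \<alpha> (gelfand_ev A x) = \<nu> x"
proof -
  let ?\<Gamma> = "gelfand X pull_alg"
  obtain k where k: "homeomorphic_maps Y ?\<Gamma> point_char k"
    using homeomorphic_point_char by (auto simp: homeomorphic_map_maps)
  then have ck: "continuous_map ?\<Gamma> Y k" and kp: "\<And>y. y \<in> topspace Y \<Longrightarrow> k (point_char y) = y"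
    and pk: "\<And>\<phi>. \<phi> \<in> topspace ?\<Gamma> \<Longrightarrow> point_char (k \<phi>) = \<phi>"
    by (auto simp: homeomorphic_maps_def)
  define r where "r = (\<lambda>\<phi> :: ('x \<Rightarrow> real) \<Rightarrow> real. restrict \<phi> pull_alg)"
  have sub: "G_subalgebra X actX pull_alg" by (rule G_subalgebra_pull_alg)
  have rch: "r \<phi> \<in> characters X pull_alg" if "\<phi> \<in> characters X A" for \<phi>
    using that sub A unfolding characters_def r_def G_subalgebra_def
    by (simp add: subset_iff)
  have proj: "continuous_map (gelfand X A) euclideanreal (\<lambda>\<phi>. \<phi> f)" if "f \<in> A" for f
    unfolding gelfand_def
    by (intro continuous_map_from_subtopology continuous_map_product_projection that)
  have topA: "topspace (gelfand X A) \<subseteq> characters X A" by (auto simp: gelfand_def)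
  have cr: "continuous_map (gelfand X A) ?\<Gamma> r"
    unfolding gelfand_def[of X pull_alg] continuous_map_in_subtopology continuous_map_componentwise
    using proj A rch topA by (auto simp: r_def subset_iff)
  have req: "r (gelfand_act X actX A g \<phi>) = gelfand_act X actX pull_alg g (r \<phi>)" for g \<phi>
    using sub A by (auto simp: r_def gelfand_act_def G_subalgebra_def fun_eq_iff subset_iff)
  have keq: "k (gelfand_act X actX pull_alg g \<phi>) = actY g (k \<phi>)" if "\<phi> \<in> topspace ?\<Gamma>" for g \<phi>
  proof -
    have "k \<phi> \<in> topspace Y" using ck that continuous_map_image_subset_topspace by blast
    then have "k (point_char (actY g (k \<phi>))) = actY g (k \<phi>)"
      using kp continuous_actionD(3)[OF Y(2)] by blast
    then show ?thesis using point_char_equivariant[OF \<open>k \<phi> \<in> topspace Y\<close>] pk[OF that] by simp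
  qed
  show thesis
  proof (rule that)
    have "r \<phi> \<in> topspace ?\<Gamma>" if "\<phi> \<in> topspace (gelfand X A)" for \<phi>
      using cr that continuous_map_image_subset_topspace by blast
    then show "G_map (gelfand X A) (gelfand_act X actX A) Y actY (k \<circ> r)"
      using continuous_map_compose[OF cr ck] by (simp add: G_map_def req keq)
    fix x assume x: "x \<in> topspace X"
    have "r (gelfand_ev A x) = gelfand_ev pull_alg x"
      using A by (auto simp: r_def gelfand_ev_def fun_eq_iff)
    then show "(k \<circ> r) (gelfand_ev A x) = \<nu> x"
      using kp[OF \<nu>_in[OF x]] by (simp add: point_char_\<nu>[OF x])
  qed
qed

end

section \<open>The maximal SUC-compactification\<close>

text \<open>Y is the closure of the diagonal image of X in the product of the chosen witnesses.
  Coordinate f of the diagonal map is the compactification belonging to f, so \<open>Ff f\<close>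
  applied to that coordinate extends f to Y.\<close>

lemma universal_SUC_compactification:
  fixes X :: "'x topology" and act :: "'g::topological_group_add \<Rightarrow> 'x \<Rightarrow> 'x"
  assumes X: "continuous_action X act"
  obtains Y :: "(('x \<Rightarrow> real) \<Rightarrow> ('x \<Rightarrow> real) \<Rightarrow> real) topology" and actY \<nu> where
    "SUC_compactification X act Y actY \<nu>"
    "SUC X act = dense_compactification.pull_alg X Y \<nu>"
proof -
  let ?I = "SUC X act"
  have "\<forall>f\<in>?I. \<exists>(Y :: (('x \<Rightarrow> real) \<Rightarrow> real) topology) actY \<nu> F.
      SUC_compactification X act Y actY \<nu> \<and> continuous_map Y euclideanreal F \<and>
      (\<forall>x\<in>topspace X. f x = F (\<nu> x))"
    by (auto simp: SUC_def)
  then obtain Yf :: "('x \<Rightarrow> real) \<Rightarrow> (('x \<Rightarrow> real) \<Rightarrow> real) topology" and af nf Ff where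
    w: "\<And>f. f \<in> ?I \<Longrightarrow> SUC_compactification X act (Yf f) (af f) (nf f) \<and>
      continuous_map (Yf f) euclideanreal (Ff f) \<and> (\<forall>x\<in>topspace X. f x = Ff f (nf f x))"
    by metis
  define P where "P = product_topology Yf ?I"
  define actP where "actP = (\<lambda>g p. \<lambda>f\<in>?I. af f g (p f))"
  define \<nu> where "\<nu> = (\<lambda>x. \<lambda>f\<in>?I. nf f x)"
  let ?Y = "subtopology P (P closure_of (\<nu> ` topspace X))"
  have SP: "SUC_space P actP"
    unfolding P_def actP_def by (rule SUC_space_product) (use w in \<open>auto simp: SUC_compactification_def\<close>)
  have "G_map X act P actP \<nu>"
    unfolding G_map_def P_def continuous_map_componentwise
    using w by (auto simp: \<nu>_def actP_def SUC_compactification_def G_compactification_def G_map_def fun_eq_iff)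
  with SP have S: "SUC_compactification X act ?Y actP \<nu>"
    using X by (rule SUC_compactification_closure)
  interpret dense_compactification X ?Y \<nu>
    using S by (rule SUC_compactification_imp_dense)
  have "f \<in> pull_alg" if f: "f \<in> ?I" for f
  proof -
    have "continuous_map P euclideanreal (Ff f \<circ> (\<lambda>p. p f))"
      unfolding P_def using f w by (intro continuous_map_compose[OF continuous_map_product_projection]) auto
    then have "continuous_map ?Y euclideanreal (Ff f \<circ> (\<lambda>p. p f))"
      by (rule continuous_map_from_subtopology)
    moreover have "f = pull (Ff f \<circ> (\<lambda>p. p f))"
    proof
      have "f \<in> extensional (topspace X)" using f by (simp add: SUC_def C_alg_iff)
      moreover have "\<nu> x f = nf f x" for x using f by (simp add: \<nu>_def)
      ultimately show "f x = pull (Ff f \<circ> (\<lambda>p. p f)) x" for x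
        using w[OF f] by (cases "x \<in> topspace X") (auto simp: pull_def extensional_def)
    qed
    ultimately show ?thesis using pull_algI by metis
  qed
  \<comment> \<open>The reverse inclusion is where the change of type occurs: Y consists of
    functions on the index set and does not fit the type in the definition of
    \<open>SUC\<close>.\<close>
  then have "SUC X act = pull_alg"
    using pull_alg_subset_SUC[OF X S] by blast
  then show thesis using that S by blast
qed

lemma SUC_algebra:
  fixes X :: "'x topology" and act :: "'g::topological_group_add \<Rightarrow> 'x \<Rightarrow> 'x"
  assumes X: "continuous_action X act"
  shows "G_subalgebra X act (SUC X act)" "SUC X act \<subseteq> RUC X act"
    and "SUC_compactification X act
      (gelfand X (SUC X act)) (gelfand_act X act (SUC X act)) (gelfand_ev (SUC X act))"
proof -
  obtain Y :: "(('x \<Rightarrow> real) \<Rightarrow> ('x \<Rightarrow> real) \<Rightarrow> real) topology" and actY \<nu> where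
    S: "SUC_compactification X act Y actY \<nu>" and
    eq: "SUC X act = dense_compactification.pull_alg X Y \<nu>"
    by (rule universal_SUC_compactification[OF X]) (rule that)
  show "G_subalgebra X act (SUC X act)" "SUC X act \<subseteq> RUC X act"
    "SUC_compactification X act
      (gelfand X (SUC X act)) (gelfand_act X act (SUC X act)) (gelfand_ev (SUC X act))"
    unfolding eq using G_subalgebra_pull_alg[OF X S] pull_alg_subset_RUC[OF X S]
      SUC_compactification_gelfand_pull_alg[OF X S] by blast+
qed

text \<open>Functions pulled back from another SUC-compactification Z lie in
  \<open>SUC X act\<close>, so characters can be restricted to them.\<close>

lemma maximal_SUC_compactification_gelfand:
  assumes X: "continuous_action X act"
  shows "maximal_SUC_compactification TYPE('z) X act
    (gelfand X (SUC X act)) (gelfand_act X act (SUC X act)) (gelfand_ev (SUC X act))"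
  unfolding maximal_SUC_compactification_def
proof (intro conjI SUC_algebra X allI impI)
  fix Z :: "'z topology" and actZ \<nu> assume S: "SUC_compactification X act Z actZ \<nu>"
  show "\<exists>\<alpha>. G_map (gelfand X (SUC X act)) (gelfand_act X act (SUC X act)) Z actZ \<alpha> \<and>
      (\<forall>x\<in>topspace X. \<nu> x = \<alpha> (gelfand_ev (SUC X act) x))"
    using G_map_from_gelfand[OF X S pull_alg_subset_SUC[OF X S]] by metis
qed

section \<open>SUC functions and cyclic spaces\<close>

text \<open>An SUC space is its own SUC-compactification via the identity. Conversely, each
  continuous function then factors through some SUC system and takes its estimates from
  there.\<close>

lemma SUC_space_iff_C_alg_eq:
  fixes X :: "'x topology" and act :: "'g::topological_group_add \<Rightarrow> 'x \<Rightarrow> 'x"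
  assumes X: "compact_G_space X act"
  shows "SUC_space X act \<longleftrightarrow> C_alg X = SUC X act"
proof
  have X': "compact_space X" "Hausdorff_space X" "continuous_action X act"
    using X by (auto simp: compact_G_space_iff)
  {
    assume S: "SUC_space X act"
    have "SUC_compactification X act X act id"
      using X S by (simp add: SUC_compactification_def G_compactification_def G_map_def closure_of_topspace)
    then have "f \<in> SUC X act" if "f \<in> C_alg X" for f
      using that by (intro SUC_I[of f X act X act id f]) (auto simp: C_alg_iff)
    then show "C_alg X = SUC X act" by (auto simp: SUC_def)
  next
    assume eq: "C_alg X = SUC X act"
    show "SUC_space X act"
    proof (rule SUC_space_separatingI[OF X, of "{F. continuous_map X euclideanreal F}"])
      fix y z assume "y \<in> topspace X" "z \<in> topspace X" "y \<noteq> z"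
      then show "\<exists>F\<in>{F. continuous_map X euclideanreal F}. F y \<noteq> F z"
        using compact_Hausdorff_separated[OF X'(1,2)] by (metis mem_Collect_eq)
    next
      fix F x and e :: real
      assume "F \<in> {F. continuous_map X euclideanreal F}" and x: "x \<in> topspace X" and e: "e > 0"
      then have F: "continuous_map X euclideanreal F" by simp
      \<comment> \<open>For the identity, \<open>pull\<close> is restriction to the carrier: F may
        be arbitrary outside it, whereas elements of \<open>C_alg X\<close> are extensional.\<close>
      interpret dense_compactification X X id
        using X' by unfold_locales (auto simp: closure_of_topspace)
      have "pull F \<in> SUC X act" using pull_C_alg[OF F] eq by simp
      then obtain Y :: "(('x \<Rightarrow> real) \<Rightarrow> real) topology" and actY \<nu> H where
        S: "SUC_compactification X act Y actY \<nu>" and H: "continuous_map Y euclideanreal H"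
        and FH: "\<forall>x\<in>topspace X. pull F x = H (\<nu> x)"
        unfolding SUC_def by blast
      have Y: "SUC_space Y actY" and
        \<nu>: "\<nu> x \<in> topspace Y" "\<And>g x. x \<in> topspace X \<Longrightarrow> \<nu> (act g x) = actY g (\<nu> x)"
        using S x by (auto simp: SUC_compactification_def G_compactification_def G_map_def continuous_map_def)
      have "F z = H (\<nu> z)" if "z \<in> topspace X" for z
        using FH that by (simp add: pull_def)
      then show "\<forall>\<^sub>F u in nhds 0. \<forall>g. \<bar>F (act g (act u x)) - F (act g x)\<bar> < e"
        using SUC_spaceD[OF Y H \<nu>(1) e] by (simp add: \<nu>(2) x continuous_actionD(3)[OF X'(3)])
    qed simp
  }
qed

lemma abs_le_sup_norm:
  assumes "f \<in> C_alg X" "x \<in> topspace X"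
  shows "\<bar>f x\<bar> \<le> sup_norm X f"
proof -
  have "(\<lambda>x\<in>topspace X. 0) \<in> C_alg X"
    by (auto simp: C_alg_iff bounded_iff intro: continuous_map_eq[of _ _ "\<lambda>_. 0"])
  from dist_le_mdist_C_metric[OF assms(1) this assms(2)] show ?thesis
    using assms(2) by (simp add: sup_norm_def)
qed

lemma Hausdorff_shift_space: "Hausdorff_space (shift_space r)"
  by (simp add: shift_space_def Hausdorff_space_product_topology Hausdorff_space_subtopology)

lemma topspace_cyclic_space:
  "topspace (cyclic_space X act f) =
    shift_space (sup_norm X f) closure_of (sharp act f ` topspace X)"
  by (simp add: cyclic_space_def Int_absorb1 closure_of_subset_topspace)

lemma continuous_map_shift_space:
  "continuous_map X (shift_space r) p \<longleftrightarrow>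
    (\<forall>g. continuous_map X euclideanreal (\<lambda>x. p x g) \<and> (\<forall>x\<in>topspace X. \<bar>p x g\<bar> \<le> r))"
proof -
  have "\<bar>a\<bar> \<le> r \<longleftrightarrow> a \<in> {- r..r}" for a by auto
  then show ?thesis
    unfolding shift_space_def continuous_map_componentwise_UNIV continuous_map_in_subtopology
    by (auto simp del: atLeastAtMost_iff)
qed

text \<open>The cyclic space is a factor of any Y that witnesses f: \<open>p\<close> extends
  \<open>sharp act f\<close> to Y. The image of \<open>p\<close> is compact, hence closed, and by
  density it is exactly the closure defining the cyclic space.\<close>

lemma SUC_cyclic_space:
  fixes X :: "'x topology" and act :: "'g::topological_group_add \<Rightarrow> 'x \<Rightarrow> 'x"
  assumes X: "continuous_action X act" and f: "f \<in> SUC X act"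
  shows "SUC_space (cyclic_space X act f) shift_act"
proof -
  let ?P = "shift_space (sup_norm X f) :: ('g \<Rightarrow> real) topology" and ?Z = "cyclic_space X act f"
  obtain Y :: "(('x \<Rightarrow> real) \<Rightarrow> real) topology" and actY \<nu> F where
    S: "SUC_compactification X act Y actY \<nu>" and F: "continuous_map Y euclideanreal F"
    and fF: "\<And>x. x \<in> topspace X \<Longrightarrow> f x = F (\<nu> x)"
    using f unfolding SUC_def by blast
  interpret dense_compactification X Y \<nu>
    using S by (rule SUC_compactification_imp_dense)
  have Y: "SUC_space Y actY" "continuous_action Y actY"
    and eq: "\<And>g x. x \<in> topspace X \<Longrightarrow> \<nu> (act g x) = actY g (\<nu> x)"
    using S by (auto simp: SUC_compactification_def G_compactification_def G_map_def compact_G_space_iff)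
  have fC: "f \<in> C_alg X" using f by (simp add: SUC_def)
  define p where "p = (\<lambda>y g. F (actY g y))"
  have cF: "continuous_map Y euclideanreal (\<lambda>y. F (actY g y))" for g
    using continuous_map_compose[OF continuous_actionD(4)[OF Y(2)] F] by (simp add: o_def)
  have p\<nu>: "sharp act f x = p (\<nu> x)" if "x \<in> topspace X" for x
    using that continuous_actionD(3)[OF X that] by (simp add: sharp_def p_def fF eq)
  have cp: "continuous_map Y ?P p"
    unfolding continuous_map_shift_space
  proof (intro allI conjI ballI)
    fix g y assume y: "y \<in> topspace Y"
    show "\<bar>p y g\<bar> \<le> sup_norm X f"
      unfolding p_def
    proof (rule abs_le_dense[OF cF _ y])
      fix x assume x: "x \<in> topspace X"
      show "\<bar>F (actY g (\<nu> x))\<bar> \<le> sup_norm X f"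
        using abs_le_sup_norm[OF fC continuous_actionD(3)[OF X x], of g]
        by (simp add: fF eq x continuous_actionD(3)[OF X x])
    qed
  qed (simp add: p_def cF)
  have sharp: "sharp act f ` topspace X = p ` \<nu> ` topspace X"
    by (auto simp: p\<nu> image_iff)
  have "closedin ?P (p ` topspace Y)"
    using compact image_compactin[OF _ cp, of "topspace Y"] compactin_imp_closedin[OF Hausdorff_shift_space]
    by (auto simp: compact_space_def)
  then have "?P closure_of (p ` \<nu> ` topspace X) \<subseteq> p ` topspace Y"
    by (rule closure_of_minimal[rotated]) (use \<nu>_in in blast)
  moreover have "p ` (Y closure_of (\<nu> ` topspace X)) \<subseteq> ?P closure_of (p ` \<nu> ` topspace X)"
    using cp by (rule continuous_map_image_closure_subset)
  ultimately have onto: "p ` topspace Y = topspace ?Z"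
    by (simp add: topspace_cyclic_space sharp dense)
  have cp': "continuous_map Y ?Z p"
    unfolding cyclic_space_def continuous_map_in_subtopology
    using cp onto by (auto simp: topspace_cyclic_space)
  show ?thesis
  proof (rule SUC_space_image[OF Y(1) cp' onto])
    show "Hausdorff_space ?Z"
      unfolding cyclic_space_def by (intro Hausdorff_space_subtopology Hausdorff_shift_space)
    show "p (actY g y) = shift_act g (p y)" if "y \<in> topspace Y" for g y
      by (simp add: p_def shift_act_def continuous_actionD(2)[OF Y(2) that])
  qed
qed

text \<open>The cyclic space itself is a witness: f is \<open>sharp act f\<close> followed by
  evaluation at 0.\<close>

lemma SUC_of_cyclic_space:
  fixes X :: "'x topology" and act :: "'g::topological_group_add \<Rightarrow> 'x \<Rightarrow> 'x"
  assumes X: "continuous_action X act" and f: "f \<in> C_alg X"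
    and S: "SUC_space (cyclic_space X act f) shift_act"
  shows "f \<in> SUC X act"
proof -
  let ?P = "shift_space (sup_norm X f) :: ('g \<Rightarrow> real) topology" and ?Z = "cyclic_space X act f"
  have cf: "continuous_map X euclideanreal f" using f by (simp add: C_alg_iff)
  note actX = continuous_actionD[OF X]
  have c: "continuous_map X ?P (sharp act f)"
    unfolding continuous_map_shift_space sharp_def
    using continuous_map_compose[OF actX(4) cf] abs_le_sup_norm[OF f] actX(3) by (auto simp: o_def)
  have sub: "sharp act f ` topspace X \<subseteq> topspace ?Z"
    unfolding topspace_cyclic_space
    using c by (intro closure_of_subset continuous_map_image_subset_topspace)
  have cZ: "continuous_map X ?Z (sharp act f)"
    unfolding cyclic_space_def continuous_map_in_subtopology
    using c sub by (auto simp: topspace_cyclic_space)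
  have "?Z closure_of (sharp act f ` topspace X) = topspace ?Z"
    using sub unfolding topspace_cyclic_space
    by (simp add: cyclic_space_def closure_of_subtopology Int_absorb1)
  moreover have "sharp act f (act g x) = shift_act g (sharp act f x)" if "x \<in> topspace X" for g x
    by (simp add: sharp_def shift_act_def actX(2)[OF that])
  ultimately have SC: "SUC_compactification X act ?Z shift_act (sharp act f)"
    using S cZ by (auto simp: SUC_compactification_def G_compactification_def G_map_def SUC_space_def)
  show ?thesis
  proof (rule SUC_I[OF f SC])
    \<comment> \<open>The coordinate description of continuity, applied to the identity, yields
      continuity of evaluation at 0.\<close>
    have "continuous_map ?P ?P id" by simp
    then have "continuous_map ?P euclideanreal (\<lambda>\<omega>. id \<omega> 0)"
      unfolding continuous_map_shift_space by blast
    then show "continuous_map ?Z euclideanreal (\<lambda>\<omega>. \<omega> 0)"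
      unfolding cyclic_space_def by (simp add: continuous_map_from_subtopology)
  qed (simp add: sharp_def actX(1))
qed

section \<open>Point-universality and the semigroup structure\<close>

lemma continuous_action_plus: "continuous_action (euclidean :: 'g::topological_group_add topology) (+)"
proof -
  have "continuous_on UNIV (\<lambda>p :: 'g \<times> 'g. fst p + snd p)"
    by (intro continuous_on_add continuous_on_fst continuous_on_snd continuous_on_id)
  then show ?thesis
    by (simp add: continuous_action_def add.assoc case_prod_beta')
qed

text \<open>For a point \<phi> the orbit map g \<mapsto> g\<phi> is equivariant for left
  translations, and the closure of its image is the orbit closure. The factor map given by
  maximality sends \<open>?ev g\<close> to g\<phi>; g = 0 gives \<phi>.\<close>

lemma point_universal_algebra_SUC:
  "point_universal_algebra (SUC (euclidean :: 'g::topological_group_add topology) (+))"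
proof -
  let ?E = "euclidean :: 'g topology"
  let ?A = "SUC ?E (+)"
  let ?S = "gelfand ?E ?A" and ?act = "gelfand_act ?E (+) ?A" and ?ev = "gelfand_ev ?A"
  note E = continuous_action_plus[where 'g = 'g]
  have S: "SUC_compactification ?E (+) ?S ?act ?ev" by (rule SUC_algebra(3)[OF E])
  then have SS: "SUC_space ?S ?act" and GS: "compact_G_space ?S ?act" and aS: "continuous_action ?S ?act"
    and cev: "continuous_map ?E ?S ?ev" and eq: "\<And>g h. ?ev (g + h) = ?act g (?ev h)"
    and dense: "?S closure_of (range ?ev) = topspace ?S"
    by (auto simp: SUC_compactification_def G_compactification_def G_map_def compact_G_space_iff)
  have "?act g (?ev 0) = ?ev g" for g using eq[of g 0, symmetric] by simp
  then have "orbit_closure ?S ?act (?ev 0) = topspace ?S"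
    using dense by (simp add: orbit_closure_def)
  moreover have "?ev 0 \<in> topspace ?S"
    using continuous_map_image_subset_topspace[OF cev] by (simp add: image_subset_iff)
  moreover have "\<exists>\<alpha>. G_map ?S ?act (subtopology ?S (orbit_closure ?S ?act \<phi>)) ?act \<alpha> \<and> \<alpha> (?ev 0) = \<phi>"
    if \<phi>: "\<phi> \<in> topspace ?S" for \<phi>
  proof -
    have "G_map ?E (+) ?S ?act (\<lambda>g. ?act g \<phi>)"
      using continuous_actionD(2,5)[OF aS \<phi>] by (simp add: G_map_def)
    from SUC_compactification_closure[OF SS this E]
    have "SUC_compactification ?E (+) (subtopology ?S (orbit_closure ?S ?act \<phi>)) ?act (\<lambda>g. ?act g \<phi>)"
      by (simp add: orbit_closure_def)
    \<comment> \<open>Orbit closures are subspaces of the Gelfand space, so maximality is taken at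
      its own point type.\<close>
    with maximal_SUC_compactification_gelfand[OF E, where 'z = "('g \<Rightarrow> real) \<Rightarrow> real"]
    have "\<exists>\<alpha>. G_map ?S ?act (subtopology ?S (orbit_closure ?S ?act \<phi>)) ?act \<alpha> \<and>
        (\<forall>g\<in>topspace ?E. ?act g \<phi> = \<alpha> (?ev g))"
      unfolding maximal_SUC_compactification_def by blast
    then obtain \<alpha> where "G_map ?S ?act (subtopology ?S (orbit_closure ?S ?act \<phi>)) ?act \<alpha>"
      "?act 0 \<phi> = \<alpha> (?ev 0)"
      by auto
    then show ?thesis using continuous_actionD(1)[OF aS \<phi>] by metis
  qed
  ultimately have "point_universal_system ?S ?act (?ev 0)"
    using GS by (simp add: point_universal_system_def)
  then show ?thesis
    using SUC_algebra(1,2)[OF E] by (simp add: point_universal_algebra_def)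
qed

text \<open>
  The product \<open>s p\<close> is the value at \<open>s\<close> of the unique equivariant map sending the base point to
  \<open>p\<close>; associativity is uniqueness of these maps.
\<close>

lemma point_universal_semigroup:
  fixes \<nu> :: "'g::topological_group_add \<Rightarrow> 's"
  assumes U: "point_universal_system S act (\<nu> 0)" and C: "G_compactification euclidean (+) S act \<nu>"
  shows "\<exists>mul. right_topological_semigroup_compactification S act mul \<nu>"
proof -
  have HS: "Hausdorff_space S" and \<nu>S: "\<And>g. \<nu> g \<in> topspace S"
    and eq: "\<And>g h. \<nu> (g + h) = act g (\<nu> h)" and dense: "S closure_of (range \<nu>) = topspace S"
    using C by (auto simp: G_compactification_def G_map_def compact_G_space_iff continuous_map_def)
  have \<nu>act: "\<nu> g = act g (\<nu> 0)" for g using eq[of g 0] by simp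
  \<comment> \<open>The codomain is enlarged from the orbit closure to S so that these maps can be
    composed.\<close>
  have "\<forall>p\<in>topspace S. \<exists>\<alpha>. G_map S act S act \<alpha> \<and> \<alpha> (\<nu> 0) = p"
    using U unfolding point_universal_system_def G_map_def continuous_map_in_subtopology by meson
  then obtain \<alpha> where \<alpha>: "\<And>p. p \<in> topspace S \<Longrightarrow> G_map S act S act (\<alpha> p)"
    "\<And>p. p \<in> topspace S \<Longrightarrow> \<alpha> p (\<nu> 0) = p"
    by metis
  have unique: "\<beta> s = \<gamma> s" if "G_map S act S act \<beta>" "G_map S act S act \<gamma>" "\<beta> (\<nu> 0) = \<gamma> (\<nu> 0)"
    "s \<in> topspace S" for \<beta> \<gamma> s
  proof (rule forall_in_closure_of_eq[of s S "range \<nu>" S \<beta> \<gamma>])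
    show "s \<in> S closure_of (range \<nu>)" using dense that(4) by simp
    show "Hausdorff_space S" "continuous_map S S \<beta>" "continuous_map S S \<gamma>" using HS that by (auto simp: G_map_def)
    fix t assume "t \<in> range \<nu>"
    then obtain g where "t = \<nu> g" by blast
    then have "t = act g (\<nu> 0)" using \<nu>act[of g] by (rule trans)
    then show "\<beta> t = \<gamma> t" using that \<nu>S by (simp add: G_map_def)
  qed
  have in_S: "\<alpha> p s \<in> topspace S" if "p \<in> topspace S" "s \<in> topspace S" for p s
    using \<alpha>(1)[OF that(1)] that(2) continuous_map_image_subset_topspace by (fastforce simp: G_map_def)
  have assoc: "\<alpha> p (\<alpha> t s) = \<alpha> (\<alpha> p t) s"
    if "s \<in> topspace S" "t \<in> topspace S" "p \<in> topspace S" for s t p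
  proof -
    have "G_map S act S act (\<alpha> p \<circ> \<alpha> t)"
      using \<alpha>(1)[OF that(2)] \<alpha>(1)[OF that(3)] in_S[OF that(2)]
      by (auto simp: G_map_def intro: continuous_map_compose)
    then have "(\<alpha> p \<circ> \<alpha> t) s = \<alpha> (\<alpha> p t) s"
      \<comment> \<open>Both maps send the base point to \<open>\<alpha> p t\<close>.\<close>
      by (rule unique) (simp_all add: \<alpha> in_S that)
    then show ?thesis by simp
  qed
  \<comment> \<open>Write \<open>\<nu> g\<close> as the g-translate of the base point and move g out
    of the equivariant map, which sends the base point to \<open>\<nu> h\<close>.\<close>
  have "\<nu> (g + h) = \<alpha> (\<nu> h) (\<nu> g)" for g h
    using \<alpha>[OF \<nu>S[of h]] \<nu>S[of 0] by (subst \<nu>act[of g]) (simp add: eq G_map_def)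
  \<comment> \<open>The arguments are swapped so that multiplication by p on the right is the
    continuous map \<open>\<alpha> p\<close>.\<close>
  then have "right_topological_semigroup_compactification S act (\<lambda>s p. \<alpha> p s) \<nu>"
    using C in_S assoc \<alpha>(1) by (auto simp: right_topological_semigroup_compactification_def G_map_def)
  then show ?thesis by blast
qed

theorem lemma4p6:
  shows
    "(\<forall>(X :: 'x topology) (act :: 'g::topological_group_add \<Rightarrow> 'x \<Rightarrow> 'x). G_space X act \<longrightarrow>
        G_subalgebra X act (SUC X act) \<and> SUC X act \<subseteq> RUC X act \<and>
        maximal_SUC_compactification TYPE('z) X act
          (gelfand X (SUC X act)) (gelfand_act X act (SUC X act)) (gelfand_ev (SUC X act))) \<and>
     (\<forall>(X :: 'x topology) (act :: 'g \<Rightarrow> 'x \<Rightarrow> 'x). compact_G_space X act \<longrightarrow>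
        (SUC_space X act \<longleftrightarrow> C_alg X = SUC X act)) \<and>
     (\<forall>(X :: 'x topology) (act :: 'g \<Rightarrow> 'x \<Rightarrow> 'x) f. G_space X act \<longrightarrow> f \<in> RUC X act \<longrightarrow>
        (f \<in> SUC X act \<longleftrightarrow> SUC_space (cyclic_space X act f) shift_act)) \<and>
     point_universal_algebra (SUC (euclidean :: 'g topology) (+)) \<and>
     (let A = SUC (euclidean :: 'g topology) (+) in
        \<exists>mul. right_topological_semigroup_compactification
          (gelfand euclidean A) (gelfand_act euclidean (+) A) mul (gelfand_ev A))"
proof (intro conjI allI impI)
  fix X :: "'x topology" and act :: "'g \<Rightarrow> 'x \<Rightarrow> 'x"
  assume "G_space X act"
  then have X: "continuous_action X act" by (simp add: G_space_def)
  show "G_subalgebra X act (SUC X act)" "SUC X act \<subseteq> RUC X act"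
    "maximal_SUC_compactification TYPE('z) X act
      (gelfand X (SUC X act)) (gelfand_act X act (SUC X act)) (gelfand_ev (SUC X act))"
    using SUC_algebra[OF X] maximal_SUC_compactification_gelfand[OF X] by blast+
next
  fix X :: "'x topology" and act :: "'g \<Rightarrow> 'x \<Rightarrow> 'x"
  assume "compact_G_space X act"
  then show "SUC_space X act \<longleftrightarrow> C_alg X = SUC X act" by (rule SUC_space_iff_C_alg_eq)
next
  fix X :: "'x topology" and act :: "'g \<Rightarrow> 'x \<Rightarrow> 'x" and f
  assume "G_space X act" and f: "f \<in> RUC X act"
  then have X: "continuous_action X act" by (simp add: G_space_def)
  show "f \<in> SUC X act \<longleftrightarrow> SUC_space (cyclic_space X act f) shift_act"
    using SUC_cyclic_space[OF X] SUC_of_cyclic_space[OF X] f by (auto simp: RUC_def)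
next
  show U: "point_universal_algebra (SUC (euclidean :: 'g topology) (+))"
    by (rule point_universal_algebra_SUC)
  have "G_compactification euclidean (+) (gelfand euclidean (SUC (euclidean :: 'g topology) (+)))
      (gelfand_act euclidean (+) (SUC euclidean (+))) (gelfand_ev (SUC euclidean (+)))"
    using SUC_algebra(3)[OF continuous_action_plus[where 'g = 'g]]
    by (simp add: SUC_compactification_def)
  then show "let A = SUC (euclidean :: 'g topology) (+) in
      \<exists>mul. right_topological_semigroup_compactification
        (gelfand euclidean A) (gelfand_act euclidean (+) A) mul (gelfand_ev A)"
    using U point_universal_semigroup unfolding Let_def point_universal_algebra_def by blast
qed

end
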